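(* For each ordinal $\alpha\le\omega^2$ (ordinal exponentiation), there exists a $0$-dimensional $T_2$ topological space $X$ with $\operatorname{ps}(X)=\alpha$.
   Context: Point separating game $G_\beta(X)$ ($X$ a topological space, $\beta$ an ordinal): two players, Seeker and Hider, make $\beta$ moves. At move $\alpha<\beta$, knowing all previous moves, the Seeker chooses an open set $U_\alpha\subseteq X$, and then the Hider chooses $V_\alpha\in\{U_\alpha, X\setminus U_\alpha\}$. The outcome is $W=\bigcap_{\alpha<\beta}V_\alpha$ (with $W=X$ if $\beta=0$). The Seeker wins iff $|W|\le 1$. For a $T_0$ space $X$, $\operatorname{ps}(X)$ is the least ordinal $\beta$ such that the Seeker has a winning strategy in $G_\beta(X)$. A space is $0$-dimensional if it has a base of clopen sets. *)

theory Defs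
  imports "HOL-Analysis.Analysis"
begin

text \<open>
  Ordinals are represented, up to order isomorphism, by (reflexive) well-orders
  \<open>r\<close> in the sense of \<^const>\<open>Well_order\<close>, compared by \<^const>\<open>ordLeq\<close>.  The elements of
  \<^term>\<open>Field r\<close> are the indices of the moves; the ordinal 0 is the empty relation.
\<close>

text \<open>The ordinal \<open>\<omega>\<^sup>2 = \<omega> \<cdot> \<omega>\<close>: \<open>\<omega>\<close> many consecutive copies of \<open>\<omega>\<close>.\<close>

definition omega_squared :: "(nat \<times> nat) rel" where
  "omega_squared = {((a, b), (c, d)). a < c \<or> a = c \<and> b \<le> d}"

lemma Well_order_omega_squared: "Well_order omega_squared"
proof -
  have F: "Field omega_squared = UNIV"
    by (force simp: omega_squared_def Field_def)
  have "wf (omega_squared - Id)"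
    by (rule wf_subset[OF wf_lex_prod[OF wf_less_than wf_less_than]])
       (auto simp: omega_squared_def)
  then show ?thesis
    unfolding well_order_on_def linear_order_on_def partial_order_on_def preorder_on_def F
    by (auto simp: omega_squared_def refl_on_def trans_def antisym_def total_on_def)
qed

definition zero_dimensional :: "'a topology \<Rightarrow> bool" where
  "zero_dimensional X \<longleftrightarrow>
     (\<exists>\<B>. (\<forall>U\<in>\<B>. openin X U \<and> closedin X U) \<and>
          openin X = arbitrary union_of (\<lambda>U. U \<in> \<B>))"

text \<open>
  A move is a pair \<open>(U, V)\<close>: the open set \<open>U\<close> chosen by the Seeker together with the
  Hider's answer \<open>V\<close>.
\<close>

definition moves :: "'a topology \<Rightarrow> ('a set \<times> 'a set) set" where
  "moves X = {(U, V). openin X U \<and> V \<in> {U, topspace X - U}}"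

definition positions :: "'a topology \<Rightarrow> 'i rel \<Rightarrow> 'i \<Rightarrow> ('i \<Rightarrow> 'a set \<times> 'a set) set" where
  "positions X r i = underS r i \<rightarrow>\<^sub>E moves X"

definition seeker_strategy ::
  "'a topology \<Rightarrow> 'i rel \<Rightarrow> ('i \<Rightarrow> ('i \<Rightarrow> 'a set \<times> 'a set) \<Rightarrow> 'a set) \<Rightarrow> bool" where
  "seeker_strategy X r \<sigma> \<longleftrightarrow> (\<forall>i\<in>Field r. \<forall>h\<in>positions X r i. openin X (\<sigma> i h))"

definition plays_following ::
  "'a topology \<Rightarrow> 'i rel \<Rightarrow> ('i \<Rightarrow> ('i \<Rightarrow> 'a set \<times> 'a set) \<Rightarrow> 'a set) \<Rightarrow>
   ('i \<Rightarrow> 'a set \<times> 'a set) set" where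
  "plays_following X r \<sigma> =
     {p \<in> Field r \<rightarrow>\<^sub>E moves X. \<forall>i\<in>Field r. fst (p i) = \<sigma> i (restrict p (underS r i))}"

text \<open>Intersecting with \<^term>\<open>topspace X\<close> only matters for the game of length 0.\<close>

definition outcome :: "'a topology \<Rightarrow> 'i rel \<Rightarrow> ('i \<Rightarrow> 'a set \<times> 'a set) \<Rightarrow> 'a set" where
  "outcome X r p = topspace X \<inter> (\<Inter>i\<in>Field r. snd (p i))"

definition seeker_wins :: "'a topology \<Rightarrow> 'i rel \<Rightarrow> bool" where
  "seeker_wins X r \<longleftrightarrow>
     (\<exists>\<sigma>. seeker_strategy X r \<sigma> \<and>
          (\<forall>p\<in>plays_following X r \<sigma>. finite (outcome X r p) \<and> card (outcome X r p) \<le> 1))"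

text \<open>
  \<open>is_ps X r\<close> says that \<open>ps(X)\<close> is the order type of \<open>r\<close>.  In the minimality clause it is
  enough to let \<open>s\<close> range over well-orders on the same type as \<open>r\<close>, because every ordinal
  below \<open>r\<close> is isomorphic to an initial segment of \<open>r\<close>.
\<close>

definition is_ps :: "'a topology \<Rightarrow> 'i rel \<Rightarrow> bool" where
  "is_ps X r \<longleftrightarrow>
     Well_order r \<and> seeker_wins X r \<and>
     (\<forall>s :: 'i rel. Well_order s \<and> seeker_wins X s \<longrightarrow> (r, s) \<in> ordLeq)"

end

theory Submission
  imports Defs
begin

text \<open>
  Replace every point of the Cantor set by a copy of a separable space \<open>F\<close>, so that
  every nonempty open set contains the whole block over some cylinder.  In the first \<open>\<omega>\<close>
  moves the Seeker can isolate one fibre by asking for the binary digits, whereas the Hider, by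
  shrinking a cylinder whose block no answer splits, can keep one fibre intact.  Hence
  \<open>ps\<close> of the resolution is \<open>\<omega> + ps(F)\<close>.  The resolution is again separable, so
  starting from a discrete space with \<open>2\<^sup>k\<close> points and iterating gives all ordinals
  \<open>\<omega> \<cdot> n + k\<close>; the disjoint sum of spaces realising \<open>\<omega> \<cdot> n\<close> gives
  \<open>\<omega>\<^sup>2\<close>.
\<close>

section \<open>The game in terms of sequences of answers\<close>

text \<open>The obstacle is to delay the Seeker by exactly \<omega> moves without disturbing
  \<open>F\<close>. In a plain product of the Cantor set with \<open>F\<close> an open set can cut
  every fibre, so questions about \<open>F\<close> may be asked before the digits are settled; since
  k + \<omega> = \<omega>, a finite factor would then be absorbed. The resolution prevents this:
  away from a given fibre, a neighbourhood takes in blocks only as a whole, and the sequence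
  \<open>g\<close> decides which ones. On the fibre itself the topology of \<open>F\<close> survives
  unchanged, so that whatever was hard about \<open>F\<close> is still ahead after \<omega> moves.
  Separability supplies \<open>g\<close> and is therefore the invariant that makes the next
  resolution possible. Ordinals are added on the left: \<omega> + (\<omega> \<cdot> n + k) =
  \<omega> \<cdot> (n + 1) + k, while \<omega> + \<omega> \<cdot> \<omega> = \<omega> \<cdot>
  \<omega>, so that in a disjoint sum the \<omega> moves spent on finding the summand cost nothing.
  All spaces are coded on \<open>nat set\<close>, which keeps the iteration within one type.\<close>

definition result :: "'a topology \<Rightarrow> 'i set \<Rightarrow> ('i \<Rightarrow> ('i \<Rightarrow> bool) \<Rightarrow> 'a set) \<Rightarrow> ('i \<Rightarrow> bool) \<Rightarrow> 'a set" where
  "result X I \<tau> f = {x \<in> topspace X. \<forall>i\<in>I. x \<in> \<tau> i f \<longleftrightarrow> f i}"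

text \<open>
  \<open>f i\<close> records whether the Hider keeps the set chosen at move \<open>i\<close>; the Seeker's
  choice \<open>\<tau> i f\<close> may depend on \<open>f\<close> only through the earlier moves \<open>P i\<close>.
\<close>

definition forces :: "'a topology \<Rightarrow> 'i set \<Rightarrow> ('i \<Rightarrow> 'i set) \<Rightarrow> ('a set \<Rightarrow> bool) \<Rightarrow> bool" where
  "forces X I P T \<longleftrightarrow> (\<exists>\<tau>. (\<forall>i\<in>I. \<forall>f. openin X (\<tau> i f)) \<and>
     (\<forall>i\<in>I. \<forall>f g. (\<forall>j\<in>P i. f j = g j) \<longrightarrow> \<tau> i f = \<tau> i g) \<and>
     (\<forall>f. T (result X I \<tau> f)))"

definition subsingleton :: "'a set \<Rightarrow> bool" where
  "subsingleton W \<longleftrightarrow> finite W \<and> card W \<le> 1"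

lemma subsingleton_iff: "subsingleton W \<longleftrightarrow> (\<forall>x\<in>W. \<forall>y\<in>W. x = y)"
proof
  assume *: "\<forall>x\<in>W. \<forall>y\<in>W. x = y"
  have "finite W"
  proof (cases "W = {}")
    case False
    then obtain x where "W \<subseteq> {x}" using * by auto
    then show ?thesis by (rule finite_subset) simp
  qed simp
  then show "subsingleton W" using * by (simp add: subsingleton_def card_le_Suc0_iff_eq)
qed (auto simp: subsingleton_def card_le_Suc0_iff_eq)

lemma forcesE:
  assumes "forces X I P T"
  obtains \<tau> where "\<And>i f. i \<in> I \<Longrightarrow> openin X (\<tau> i f)"
    "\<And>i f g. i \<in> I \<Longrightarrow> (\<And>j. j \<in> P i \<Longrightarrow> f j = g j) \<Longrightarrow> \<tau> i f = \<tau> i g"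
    "\<And>f. T (result X I \<tau> f)"
proof -
  from assms obtain \<tau> where "\<forall>i\<in>I. \<forall>f. openin X (\<tau> i f)"
    "\<forall>i\<in>I. \<forall>f g. (\<forall>j\<in>P i. f j = g j) \<longrightarrow> \<tau> i f = \<tau> i g" "\<forall>f. T (result X I \<tau> f)"
    unfolding forces_def by (elim exE conjE)
  then show thesis by (intro that[of \<tau>]) blast+
qed

lemma forcesI:
  assumes "\<And>i f. i \<in> I \<Longrightarrow> openin X (\<tau> i f)"
    "\<And>i f g. i \<in> I \<Longrightarrow> (\<And>j. j \<in> P i \<Longrightarrow> f j = g j) \<Longrightarrow> \<tau> i f = \<tau> i g"
    "\<And>f. T (result X I \<tau> f)"
  shows "forces X I P T"
  unfolding forces_def using assms by (intro exI[of _ \<tau>] conjI ballI allI impI) blast+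

lemma forces_mono:
  assumes "forces X I P T" "\<And>W. W \<subseteq> topspace X \<Longrightarrow> T W \<Longrightarrow> T' W"
  shows "forces X I P T'"
proof -
  obtain \<tau> where op: "\<And>i f. i \<in> I \<Longrightarrow> openin X (\<tau> i f)"
    and dep: "\<And>i f g. i \<in> I \<Longrightarrow> (\<And>j. j \<in> P i \<Longrightarrow> f j = g j) \<Longrightarrow> \<tau> i f = \<tau> i g"
    and win: "\<And>f. T (result X I \<tau> f)"
    using forcesE[OF assms(1)] by blast
  show ?thesis
  proof (rule forcesI[where \<tau> = \<tau>])
    show "T' (result X I \<tau> f)" for f
      using win by (intro assms(2)) (auto simp: result_def)
  qed (rule op, assumption, rule dep)
qed

lemma forces_weaken:
  assumes "forces X I P T" "\<And>i. i \<in> I \<Longrightarrow> P i \<subseteq> P' i"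
  shows "forces X I P' T"
proof -
  obtain \<tau> where op: "\<And>i f. i \<in> I \<Longrightarrow> openin X (\<tau> i f)"
    and dep: "\<And>i f g. i \<in> I \<Longrightarrow> (\<And>j. j \<in> P i \<Longrightarrow> f j = g j) \<Longrightarrow> \<tau> i f = \<tau> i g"
    and win: "\<And>f. T (result X I \<tau> f)"
    using forcesE[OF assms(1)] by blast
  show ?thesis
  proof (rule forcesI[where \<tau> = \<tau>])
    show "\<tau> i f = \<tau> i g" if "i \<in> I" "\<And>j. j \<in> P' i \<Longrightarrow> f j = g j" for i f g
      using that assms(2) by (intro dep) auto
  qed (rule op, assumption, rule win)
qed

lemma outcome_eq_result:
  assumes "\<And>i. i \<in> Field r \<Longrightarrow> snd (p i) = (if f i then \<tau> i f else topspace X - \<tau> i f)"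
  shows "outcome X r p = result X (Field r) \<tau> f"
proof (rule set_eqI)
  fix x
  have "x \<in> outcome X r p \<longleftrightarrow> x \<in> topspace X \<and> (\<forall>i\<in>Field r. x \<in> snd (p i))"
    by (simp add: outcome_def)
  also have "\<dots> \<longleftrightarrow> x \<in> result X (Field r) \<tau> f"
    using assms by (auto simp: result_def)
  finally show "x \<in> outcome X r p \<longleftrightarrow> x \<in> result X (Field r) \<tau> f" .
qed

lemma seeker_wins_if_forces:
  assumes "forces X (Field r) (underS r) subsingleton"
  shows "seeker_wins X r"
proof -
  obtain \<tau> where op: "\<And>i f. i \<in> Field r \<Longrightarrow> openin X (\<tau> i f)"
    and dep: "\<And>i f g. i \<in> Field r \<Longrightarrow> (\<And>j. j \<in> underS r i \<Longrightarrow> f j = g j) \<Longrightarrow> \<tau> i f = \<tau> i g"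
    and win: "\<And>f. subsingleton (result X (Field r) \<tau> f)"
    using forcesE[OF assms] by blast
  \<comment> \<open>A position records an answer as positive iff the Hider kept the offered set.
    Outside the earlier moves \<open>h\<close> has arbitrary values, which do no harm because
    \<open>\<tau> i\<close> looks only at earlier answers.\<close>
  define \<sigma> where "\<sigma> i h = \<tau> i (\<lambda>j. snd (h j) = fst (h j))" for i and h :: "_ \<Rightarrow> 'a set \<times> 'a set"
  have "subsingleton (outcome X r p)" if p: "p \<in> plays_following X r \<sigma>" for p
  proof -
    define f where "f j \<longleftrightarrow> snd (p j) = fst (p j)" for j
    have "snd (p i) = (if f i then \<tau> i f else topspace X - \<tau> i f)" if i: "i \<in> Field r" for i
    proof -
      have "fst (p i) = \<tau> i f"
      proof -
        have "\<sigma> i (restrict p (underS r i)) = \<tau> i f"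
          unfolding \<sigma>_def by (rule dep) (use i in \<open>simp_all add: f_def\<close>)
        moreover have "fst (p i) = \<sigma> i (restrict p (underS r i))"
          using p i by (simp add: plays_following_def)
        ultimately show ?thesis by simp
      qed
      moreover have "p i \<in> moves X" using p i by (auto simp: plays_following_def)
      ultimately show ?thesis by (cases "p i") (auto simp: f_def moves_def)
    qed
    then have "outcome X r p = result X (Field r) \<tau> f"
      by (rule outcome_eq_result)
    then show ?thesis using win by simp
  qed
  moreover have "seeker_strategy X r \<sigma>"
    using op by (simp add: seeker_strategy_def \<sigma>_def)
  ultimately show ?thesis unfolding seeker_wins_def subsingleton_def by blast
qed

lemma forces_if_seeker_wins:
  fixes X :: "'a topology" and r :: "'i rel"
  assumes r: "Well_order r" and "seeker_wins X r"
  shows "forces X (Field r) (underS r) subsingleton"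
proof -
  obtain \<sigma> where st: "seeker_strategy X r \<sigma>"
    and win: "\<And>p. p \<in> plays_following X r \<sigma> \<Longrightarrow> subsingleton (outcome X r p)"
    using assms(2) unfolding seeker_wins_def subsingleton_def by blast
  have wf: "wf (r - Id)" using r by (simp add: well_order_on_def)
  have tr: "underS r j \<subseteq> underS r i" if "j \<in> underS r i" for i j
    using r that unfolding underS_def well_order_on_def linear_order_on_def partial_order_on_def
      preorder_on_def trans_def antisym_def by blast
  have Fi: "underS r i \<subseteq> Field r" for i
    by (auto simp: underS_def Field_def)
  \<comment> \<open>\<open>H f p i\<close> is move \<open>i\<close> of the play in which the Seeker
    follows \<open>\<sigma>\<close> and the Hider answers as \<open>f\<close> prescribes. Recursion
    along \<open>r - Id\<close> produces the whole play at once, limit stages included.\<close>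
  define H where "H f p i = (let U = \<sigma> i (restrict p (underS r i)) in (U, if f i then U else topspace X - U))"
    for f :: "'i \<Rightarrow> bool" and p :: "'i \<Rightarrow> 'a set \<times> 'a set" and i
  define p where "p f = wfrec (r - Id) (H f)" for f
  have p_eq: "p f i = H f (p f) i" for f i
  proof -
    have "restrict (cut (p f) (r - Id) i) (underS r i) = restrict (p f) (underS r i)"
      by (auto simp: restrict_def cut_def underS_def)
    then show ?thesis unfolding p_def by (subst wfrec[OF wf]) (simp add: H_def)
  qed
  have mv: "p f i \<in> moves X" if "i \<in> Field r" for f i
    using wf that
  proof (induction i)
    case (less i)
    have "p f j \<in> moves X" if "j \<in> underS r i" for j
      using less that Fi by (auto simp: underS_def)
    then have "restrict (p f) (underS r i) \<in> positions X r i"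
      by (auto simp: positions_def)
    then have "openin X (\<sigma> i (restrict (p f) (underS r i)))"
      using st less.prems by (simp add: seeker_strategy_def)
    then show ?case by (subst p_eq) (simp add: H_def Let_def moves_def)
  qed
  have dep: "fst (p f i) = fst (p g i)" if "\<And>j. j \<in> underS r i \<Longrightarrow> f j = g j" for f g i
    using wf that
  proof (induction i)
    case (less i)
    have "p f j = p g j" if j: "j \<in> underS r i" for j
    proof -
      have "fst (p f j) = fst (p g j)"
        using less.IH[of j] j less.prems tr[OF j] by (auto simp: underS_def)
      then show ?thesis using less.prems[OF j] p_eq[of f j] p_eq[of g j] by (simp add: H_def Let_def)
    qed
    then have "restrict (p f) (underS r i) = restrict (p g) (underS r i)" by auto
    then show ?case using p_eq[of f i] p_eq[of g i] by (simp add: H_def Let_def)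
  qed
  have snd_p: "snd (p f i) = (if f i then fst (p f i) else topspace X - fst (p f i))" for f i
    using p_eq[of f i] by (simp add: H_def Let_def)
  show ?thesis
  proof (rule forcesI[where \<tau> = "\<lambda>i f. fst (p f i)"])
    show "openin X (fst (p f i))" if "i \<in> Field r" for i f
      using mv[OF that, of f] by (auto simp: moves_def)
    show "subsingleton (result X (Field r) (\<lambda>i f. fst (p f i)) f)" for f
    proof -
      let ?p = "restrict (p f) (Field r)"
      have "fst (?p i) = \<sigma> i (restrict ?p (underS r i))" if "i \<in> Field r" for i
      proof -
        have "restrict ?p (underS r i) = restrict (p f) (underS r i)"
          using Fi[of i] by (auto simp: restrict_def fun_eq_iff)
        then show ?thesis using that p_eq[of f i] by (simp add: H_def Let_def)
      qed
      then have "?p \<in> plays_following X r \<sigma>"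
        using mv by (auto simp: plays_following_def)
      moreover have "outcome X r ?p = result X (Field r) (\<lambda>i f. fst (p f i)) f"
        by (rule outcome_eq_result) (use snd_p in simp)
      ultimately show ?thesis using win by metis
    qed
  qed (rule dep)
qed

section \<open>Reindexing, pulling back and concatenating games\<close>

lemma forces_bij:
  assumes h: "bij_betw h I I'" and P: "\<And>i. i \<in> I \<Longrightarrow> P i \<subseteq> I"
    and P': "\<And>i. i \<in> I \<Longrightarrow> P' (h i) = h ` P i"
  shows "forces X I P T \<longleftrightarrow> forces X I' P' T"
proof
  have inv: "inv_into I h (h i) = i" if "i \<in> I" for i
    using h that by (simp add: bij_betw_def)
  have I': "I' = h ` I" using h by (simp add: bij_betw_def)
  {
    assume forced: "forces X I P T"
    obtain \<tau> where op: "\<And>i f. i \<in> I \<Longrightarrow> openin X (\<tau> i f)"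
      and dep: "\<And>i f g. i \<in> I \<Longrightarrow> (\<And>j. j \<in> P i \<Longrightarrow> f j = g j) \<Longrightarrow> \<tau> i f = \<tau> i g"
      and win: "\<And>f. T (result X I \<tau> f)"
      using forcesE[OF forced] by blast
    show "forces X I' P' T"
    proof (rule forcesI[where \<tau> = "\<lambda>i f. \<tau> (inv_into I h i) (f \<circ> h)"])
      show "T (result X I' (\<lambda>i f. \<tau> (inv_into I h i) (f \<circ> h)) f)" for f
      proof -
        have "result X I' (\<lambda>i f. \<tau> (inv_into I h i) (f \<circ> h)) f = result X I \<tau> (f \<circ> h)"
          by (simp add: result_def I' inv)
        then show ?thesis using win by simp
      qed
      show "openin X (\<tau> (inv_into I h i) (f \<circ> h))" if "i \<in> I'" for i f
        using that by (intro op) (auto simp: I' inv)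
      show "\<tau> (inv_into I h i) (f \<circ> h) = \<tau> (inv_into I h i) (g \<circ> h)"
        if "i \<in> I'" "\<And>j. j \<in> P' i \<Longrightarrow> f j = g j" for i f g
        using that by (intro dep) (auto simp: I' inv P')
    qed
  next
    assume forced: "forces X I' P' T"
    obtain \<tau> where op: "\<And>i f. i \<in> I' \<Longrightarrow> openin X (\<tau> i f)"
      and dep: "\<And>i f g. i \<in> I' \<Longrightarrow> (\<And>j. j \<in> P' i \<Longrightarrow> f j = g j) \<Longrightarrow> \<tau> i f = \<tau> i g"
      and win: "\<And>f. T (result X I' \<tau> f)"
      using forcesE[OF forced] by blast
    let ?k = "inv_into I h"
    show "forces X I P T"
    proof (rule forcesI[where \<tau> = "\<lambda>i f. \<tau> (h i) (f \<circ> ?k)"])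
      show "\<tau> (h i) (f \<circ> ?k) = \<tau> (h i) (g \<circ> ?k)"
        if "i \<in> I" "\<And>j. j \<in> P i \<Longrightarrow> f j = g j" for i f g
        using that P[of i] by (intro dep) (auto simp: I' P' inv subset_iff)
      show "T (result X I (\<lambda>i f. \<tau> (h i) (f \<circ> ?k)) f)" for f
      proof -
        have "result X I (\<lambda>i f. \<tau> (h i) (f \<circ> ?k)) f = result X I' \<tau> (f \<circ> ?k)"
          by (simp add: result_def I' inv)
        then show ?thesis using win by simp
      qed
      show "openin X (\<tau> (h i) (f \<circ> ?k))" if "i \<in> I" for i f
        using that by (intro op) (simp add: I')
    qed
  }
qed

text \<open>The preimages of the Seeker's sets are open, and \<phi> maps what is left of
  \<open>X\<close> into what is left of \<open>Y\<close>. This serves for upper bounds, when a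
  residual set maps into a known space, and for lower bounds, when a known space sits inside a
  residual set.\<close>

lemma forces_subsingleton_inj:
  assumes f: "continuous_map X Y \<phi>" "inj_on \<phi> (topspace X)"
    and "forces Y I P subsingleton"
  shows "forces X I P subsingleton"
proof -
  obtain \<tau> where op: "\<And>i f. i \<in> I \<Longrightarrow> openin Y (\<tau> i f)"
    and dep: "\<And>i f g. i \<in> I \<Longrightarrow> (\<And>j. j \<in> P i \<Longrightarrow> f j = g j) \<Longrightarrow> \<tau> i f = \<tau> i g"
    and win: "\<And>f. subsingleton (result Y I \<tau> f)"
    using forcesE[OF assms(3)] by blast
  show ?thesis
  proof (rule forcesI[where \<tau> = "\<lambda>i f. {x \<in> topspace X. \<phi> x \<in> \<tau> i f}"])
    show "subsingleton (result X I (\<lambda>i f. {x \<in> topspace X. \<phi> x \<in> \<tau> i f}) g)" for g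
    proof -
      have "\<phi> x \<in> result Y I \<tau> g" if "x \<in> result X I (\<lambda>i f. {x \<in> topspace X. \<phi> x \<in> \<tau> i f}) g" for x
        using that continuous_map_funspace[OF f(1)] by (auto simp: result_def)
      moreover have "result X I (\<lambda>i f. {x \<in> topspace X. \<phi> x \<in> \<tau> i f}) g \<subseteq> topspace X"
        by (auto simp: result_def)
      ultimately show ?thesis
        using win[of g] f(2) unfolding subsingleton_iff by (meson inj_onD subsetD)
    qed
    show "openin X {x \<in> topspace X. \<phi> x \<in> \<tau> i g}" if "i \<in> I" for i g
      using openin_continuous_map_preimage[OF f(1) op[OF that]] .
    show "{x \<in> topspace X. \<phi> x \<in> \<tau> i g} = {x \<in> topspace X. \<phi> x \<in> \<tau> i h}"
      if "i \<in> I" "\<And>j. j \<in> P i \<Longrightarrow> g j = h j" for i g h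
    proof -
      have "\<tau> i g = \<tau> i h" using that by (intro dep)
      then show ?thesis by simp
    qed
  qed
qed

text \<open>Once the moves in \<open>J\<close> are answered, only the residual set \<open>W\<close>
  matters, and the moves in \<open>K\<close> form a game on the subspace \<open>W\<close>. A whole
  game can thus be the target of an earlier one, which is why \<open>forces\<close> has a target
  parameter.\<close>

lemma forces_split:
  assumes disj: "J \<inter> K = {}" and PJ: "\<And>j. j \<in> J \<Longrightarrow> P j \<subseteq> J"
    and PK: "\<And>k. k \<in> K \<Longrightarrow> J \<subseteq> P k \<and> P k \<subseteq> J \<union> K"
  shows "forces X (J \<union> K) P T \<longleftrightarrow>
    forces X J P (\<lambda>W. forces (subtopology X W) K (\<lambda>k. P k \<inter> K) T)"
proof
  assume forced: "forces X (J \<union> K) P T"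
  obtain \<tau> where op: "\<And>i f. i \<in> J \<union> K \<Longrightarrow> openin X (\<tau> i f)"
    and dep: "\<And>i f g. i \<in> J \<union> K \<Longrightarrow> (\<And>j. j \<in> P i \<Longrightarrow> f j = g j) \<Longrightarrow> \<tau> i f = \<tau> i g"
    and win: "\<And>f. T (result X (J \<union> K) \<tau> f)"
    using forcesE[OF forced] by blast
  show "forces X J P (\<lambda>W. forces (subtopology X W) K (\<lambda>k. P k \<inter> K) T)"
  proof (rule forcesI[where \<tau> = \<tau>])
    fix f
    let ?W = "result X J \<tau> f"
    \<comment> \<open>\<open>m g\<close> freezes the given answers \<open>f\<close> on
      \<open>J\<close> and lets \<open>g\<close> answer the rest, so the given strategy, run on
      \<open>m g\<close>, plays the second game.\<close>
    define m where "m g = (\<lambda>j. if j \<in> J then f j else g j)" for g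
    show "forces (subtopology X ?W) K (\<lambda>k. P k \<inter> K) T"
    proof (rule forcesI[where \<tau> = "\<lambda>i g. ?W \<inter> \<tau> i (m g)"])
      show "openin (subtopology X ?W) (?W \<inter> \<tau> i (m g))" if "i \<in> K" for i g
        using op that by (auto simp: openin_subtopology)
      show "?W \<inter> \<tau> i (m g) = ?W \<inter> \<tau> i (m h)"
        if "i \<in> K" "\<And>j. j \<in> P i \<inter> K \<Longrightarrow> g j = h j" for i g h
      proof -
        have "\<tau> i (m g) = \<tau> i (m h)"
          using that PK[of i] by (intro dep) (auto simp: m_def)
        then show ?thesis by simp
      qed
      show "T (result (subtopology X ?W) K (\<lambda>i g. ?W \<inter> \<tau> i (m g)) g)" for g
      proof -
        have "\<tau> j f = \<tau> j (m g)" if "j \<in> J" for j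
          using that PJ[of j] by (intro dep) (auto simp: m_def)
        then have W: "?W = result X J \<tau> (m g)" by (simp add: result_def m_def)
        have K: "k \<in> K \<Longrightarrow> m g k = g k" for k using disj by (auto simp: m_def)
        have "result (subtopology X ?W) K (\<lambda>i g. ?W \<inter> \<tau> i (m g)) g =
            {x \<in> ?W. \<forall>k\<in>K. x \<in> \<tau> k (m g) \<longleftrightarrow> m g k}"
          using K by (auto simp: result_def)
        also have "\<dots> = result X (J \<union> K) \<tau> (m g)"
          unfolding W by (auto simp: result_def)
        finally show ?thesis using win by simp
      qed
    qed
  qed (use op in blast, rule dep, auto)
next
  assume forced: "forces X J P (\<lambda>W. forces (subtopology X W) K (\<lambda>k. P k \<inter> K) T)"
  obtain \<tau> where op: "\<And>i f. i \<in> J \<Longrightarrow> openin X (\<tau> i f)"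
    and dep: "\<And>i f g. i \<in> J \<Longrightarrow> (\<And>j. j \<in> P i \<Longrightarrow> f j = g j) \<Longrightarrow> \<tau> i f = \<tau> i g"
    and win: "\<And>f. forces (subtopology X (result X J \<tau> f)) K (\<lambda>k. P k \<inter> K) T"
    using forcesE[OF forced] by blast
  define W where "W f = result X J \<tau> f" for f
  have "\<forall>f. \<exists>\<rho>. (\<forall>i\<in>K. \<forall>g. openin (subtopology X (W f)) (\<rho> i g)) \<and>
      (\<forall>i\<in>K. \<forall>g h. (\<forall>j\<in>P i \<inter> K. g j = h j) \<longrightarrow> \<rho> i g = \<rho> i h) \<and>
      (\<forall>g. T (result (subtopology X (W f)) K \<rho> g))"
    using win unfolding forces_def W_def by (intro allI)
  from choice[OF this] obtain \<rho> where \<rho>: "\<forall>f. (\<forall>i\<in>K. \<forall>g. openin (subtopology X (W f)) (\<rho> f i g)) \<and>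
      (\<forall>i\<in>K. \<forall>g h. (\<forall>j\<in>P i \<inter> K. g j = h j) \<longrightarrow> \<rho> f i g = \<rho> f i h) \<and>
      (\<forall>g. T (result (subtopology X (W f)) K (\<rho> f) g))"
    by (elim exE)
  have op': "\<And>f i g. i \<in> K \<Longrightarrow> openin (subtopology X (W f)) (\<rho> f i g)"
    and dep': "\<And>f i g h. i \<in> K \<Longrightarrow> (\<And>j. j \<in> P i \<inter> K \<Longrightarrow> g j = h j) \<Longrightarrow> \<rho> f i g = \<rho> f i h"
    and win': "\<And>f g. T (result (subtopology X (W f)) K (\<rho> f) g)"
    using \<rho> by blast+
  \<comment> \<open>\<open>c f\<close> keeps the answers on \<open>J\<close> and sets all others to
    \<open>False\<close>. Sequences that agree on \<open>J\<close> thereby receive the same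
    continuation \<open>\<rho>\<close>, although \<open>\<rho>\<close> was picked by choice.\<close>
  define c where "c f = (\<lambda>j. j \<in> J \<and> f j)" for f
  \<comment> \<open>The continuation offers sets that are open only in the residual subspace; any
    open set of \<open>X\<close> with the same trace on it will do.\<close>
  define \<tau>' where "\<tau>' i f = (if i \<in> J then \<tau> i f else
      (SOME U. openin X U \<and> \<rho> (c f) i f = U \<inter> W (c f)))" for i f
  have K: "openin X (\<tau>' k f) \<and> \<rho> (c f) k f = \<tau>' k f \<inter> W (c f)" if "k \<in> K" for k f
  proof -
    have "\<exists>U. openin X U \<and> \<rho> (c f) k f = U \<inter> W (c f)"
      using op'[OF that] by (simp add: openin_subtopology)
    then show ?thesis using that disj someI_ex[of "\<lambda>U. openin X U \<and> \<rho> (c f) k f = U \<inter> W (c f)"]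
      by (auto simp: \<tau>'_def)
  qed
  show "forces X (J \<union> K) P T"
  proof (rule forcesI[where \<tau> = \<tau>'])
    show "openin X (\<tau>' i f)" if "i \<in> J \<union> K" for i f
    proof (cases "i \<in> J")
      case True
      then show ?thesis using op by (simp add: \<tau>'_def)
    qed (use that K in blast)
    show "\<tau>' i f = \<tau>' i g" if "i \<in> J \<union> K" "\<And>j. j \<in> P i \<Longrightarrow> f j = g j" for i f g
    proof (cases "i \<in> J")
      case True
      then have "\<tau> i f = \<tau> i g" using that by (intro dep) auto
      then show ?thesis using True by (simp add: \<tau>'_def)
    next
      case False
      then have i: "i \<in> K" using that by auto
      have c: "c f = c g" using PK[OF i] that by (auto simp: c_def)
      have "\<rho> (c f) i f = \<rho> (c f) i g" using that by (intro dep'[OF i]) auto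
      then show ?thesis using c False by (simp add: \<tau>'_def)
    qed
    show "T (result X (J \<union> K) \<tau>' f)" for f
    proof -
      have "\<tau> j f = \<tau> j (c f)" if "j \<in> J" for j
        using that PJ[of j] by (intro dep) (auto simp: c_def)
      then have W: "W (c f) = result X J \<tau>' f" unfolding W_def by (simp add: result_def c_def \<tau>'_def)
      have "result X (J \<union> K) \<tau>' f = {x \<in> W (c f). \<forall>k\<in>K. x \<in> \<tau>' k f \<longleftrightarrow> f k}"
        unfolding W by (auto simp: result_def)
      also have "\<dots> = result (subtopology X (W (c f))) K (\<rho> (c f)) f"
      proof -
        have "x \<in> W (c f) \<longleftrightarrow> x \<in> topspace X \<and> (\<forall>j\<in>J. x \<in> \<tau>' j f \<longleftrightarrow> f j)" for x
          by (simp add: W result_def)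
        then show ?thesis using K by (auto simp: result_def)
      qed
      finally show ?thesis using win' by simp
    qed
  qed
qed

section \<open>Ordinals up to the square of omega\<close>

definition lex_below :: "nat \<times> nat \<Rightarrow> (nat \<times> nat) set" where
  "lex_below p = {(c, d). c < fst p \<or> c = fst p \<and> d < snd p}"

text \<open>The index set \<^term>\<open>lex_below (n, k)\<close> has order type \<open>\<omega> \<cdot> n + k\<close>.\<close>

abbreviation wins :: "nat \<Rightarrow> nat \<Rightarrow> 'a topology \<Rightarrow> bool" where
  "wins n k X \<equiv> forces X (lex_below (n, k)) lex_below subsingleton"

lemma underS_omega_squared: "underS omega_squared p = lex_below p"
  by (cases p) (auto simp: underS_def omega_squared_def lex_below_def)

text \<open>Left addition of \<omega>: column 0 carries the first \<omega> moves and
  \<open>D\<close> is shifted one column to the right. Since \<open>D\<close> is closed downwards,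
  the predecessors of a shifted index within the shifted copy are exactly the shifted
  predecessors.\<close>

lemma forces_omega_plus:
  fixes D :: "(nat \<times> nat) set"
  assumes "D' = range (Pair 0) \<union> apfst Suc ` D" and D: "\<And>p. p \<in> D \<Longrightarrow> lex_below p \<subseteq> D"
  shows "forces X D' lex_below T \<longleftrightarrow>
    forces X (UNIV :: nat set) lessThan (\<lambda>W. forces (subtopology X W) D lex_below T)"
proof -
  let ?K = "apfst Suc ` D"
  have "lex_below p \<subseteq> range (Pair 0) \<union> ?K" if pK: "p \<in> ?K" for p
  proof
    fix q assume q: "q \<in> lex_below p"
    obtain a b where p: "p = (Suc a, b)" "(a, b) \<in> D" using pK by auto
    show "q \<in> range (Pair 0) \<union> ?K"
    proof (cases "fst q")
      case 0
      then show ?thesis by (cases q) auto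
    next
      case (Suc c)
      then have "(c, snd q) \<in> D" using D[OF p(2)] q p by (auto simp: lex_below_def)
      then show ?thesis using Suc by (intro UnI2 image_eqI[of _ _ "(c, snd q)"]) (cases q, auto)
    qed
  qed
  then have "forces X D' lex_below T \<longleftrightarrow>
    forces X (range (Pair 0)) lex_below (\<lambda>W. forces (subtopology X W) ?K (\<lambda>k. lex_below k \<inter> ?K) T)"
    unfolding assms(1) by (intro forces_split) (auto simp: lex_below_def)
  also have "\<dots> \<longleftrightarrow> forces X (UNIV :: nat set) lessThan (\<lambda>W. forces (subtopology X W) ?K (\<lambda>k. lex_below k \<inter> ?K) T)"
    by (rule forces_bij[symmetric, where h = "Pair 0 :: nat \<Rightarrow> nat \<times> nat"]) (auto simp: bij_betw_def inj_on_def lex_below_def)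
  also have "(\<lambda>W. forces (subtopology X W) ?K (\<lambda>k. lex_below k \<inter> ?K) T) =
      (\<lambda>W. forces (subtopology X W) D lex_below T)"
  proof (intro ext forces_bij[symmetric, where h = "apfst Suc :: nat \<times> nat \<Rightarrow> nat \<times> nat"])
    show "lex_below (apfst Suc p) \<inter> ?K = apfst Suc ` lex_below p" if "p \<in> D" for p
      using D[OF that] by (cases p) (force simp: lex_below_def)
  qed (use D in \<open>auto simp: bij_betw_def inj_on_def\<close>)
  finally show ?thesis .
qed

lemma lex_below_down: "p \<in> lex_below q \<Longrightarrow> lex_below p \<subseteq> lex_below q"
  by (auto simp: lex_below_def)

lemma wins_Suc:
  "wins (Suc n) k X \<longleftrightarrow> forces X (UNIV :: nat set) lessThan (\<lambda>W. wins n k (subtopology X W))"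
proof (rule forces_omega_plus)
  have "p \<in> range (Pair 0) \<union> apfst Suc ` lex_below (n, k)" if "p \<in> lex_below (Suc n, k)" for p
    using that by (cases p; cases "fst p") (auto simp: lex_below_def image_iff)
  then show "lex_below (Suc n, k) = range (Pair 0) \<union> apfst Suc ` lex_below (n, k)"
    by (auto simp: lex_below_def)
qed (use lex_below_down in blast)

text \<open>This is the identity \<omega> + \<omega> \<cdot> \<omega> = \<omega> \<cdot> \<omega>,
  obtained by splitting off column 0.\<close>

lemma forces_omega_squared:
  "forces X UNIV lex_below T \<longleftrightarrow>
    forces X (UNIV :: nat set) lessThan (\<lambda>W. forces (subtopology X W) UNIV lex_below T)"
proof (rule forces_omega_plus)
  have "p \<in> range (Pair 0) \<union> range (apfst Suc)" for p :: "nat \<times> nat"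
    by (cases p; cases "fst p") (auto simp: image_iff)
  then show "(UNIV :: (nat \<times> nat) set) = range (Pair 0) \<union> range (apfst Suc)"
    by auto
qed auto

lemma forces_if_subsingleton:
  assumes "subsingleton (topspace X)"
  shows "forces X I P subsingleton"
  by (rule forcesI[where \<tau> = "\<lambda>_ _. {}"]) (use assms in \<open>auto simp: subsingleton_iff result_def\<close>)

text \<open>After a win at \<open>(n, k)\<close> the remaining moves are filled with dummy
  choices.\<close>

lemma forces_omega_squared_if_wins:
  assumes "wins n k X"
  shows "forces X UNIV lex_below subsingleton"
proof -
  let ?J = "lex_below (n, k)"
  have "forces X (?J \<union> - ?J) lex_below subsingleton"
  proof (subst forces_split)
    show "forces X ?J lex_below
        (\<lambda>W. forces (subtopology X W) (- ?J) (\<lambda>k. lex_below k \<inter> - ?J) subsingleton)"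
      by (rule forces_mono[OF assms], rule forces_if_subsingleton) (simp add: inf.absorb2)
  qed (auto simp: lex_below_def)
  then show ?thesis by simp
qed

section \<open>Games of finite length: k answers separate at most \<open>2 ^ k\<close>
  points\<close>

lemma wins_0_card:
  assumes "wins 0 k X"
  shows "finite (topspace X) \<and> card (topspace X) \<le> 2 ^ k"
proof -
  \<comment> \<open>A move with no earlier moves to consult offers one fixed set, so the residual
    sets of its two answers cover the space.\<close>
  have step: "finite (topspace Y) \<and> card (topspace Y) \<le> 2 * N"
    if forced: "forces Y {p} (\<lambda>_. {}) (\<lambda>W. finite W \<and> card W \<le> N)" for N and p :: "nat \<times> nat" and Y :: "'a topology"
  proof -
    from forced obtain \<tau> where
      indep: "\<forall>i\<in>{p}. \<forall>f g. (\<forall>j\<in>{}. f j = g j) \<longrightarrow> \<tau> i f = \<tau> i g"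
      and win: "\<forall>f. finite (result Y {p} \<tau> f) \<and> card (result Y {p} \<tau> f) \<le> N"
      unfolding forces_def by (elim exE conjE)
    have dep: "\<tau> p (\<lambda>_. True) = \<tau> p (\<lambda>_. False)"
      using indep by blast
    let ?A = "result Y {p} \<tau> (\<lambda>_. True)" and ?B = "result Y {p} \<tau> (\<lambda>_. False)"
    have "topspace Y = ?A \<union> ?B"
      using dep by (auto simp: result_def)
    moreover have "finite ?A" "finite ?B" "card ?A \<le> N" "card ?B \<le> N"
      using win by blast+
    ultimately show ?thesis
      using card_Un_le[of ?A ?B] by simp
  qed
  \<comment> \<open>The bound \<open>N\<close> is left free because absorbing the last move
    \<open>(0, k)\<close> into the target replaces \<open>N\<close> by \<open>2 * N\<close>.\<close>
  have "finite (topspace X) \<and> card (topspace X) \<le> N * 2 ^ k"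
    if "forces X (lex_below (0, k)) lex_below (\<lambda>W. finite W \<and> card W \<le> N)" for N
    using that
  proof (induction k arbitrary: N)
    case 0
    have "lex_below (0, 0) = {}" by (auto simp: lex_below_def)
    with 0 have "forces X ({} :: (nat \<times> nat) set) lex_below (\<lambda>W. finite W \<and> card W \<le> N)"
      by simp
    then obtain \<tau> where "\<forall>f. finite (result X ({} :: (nat \<times> nat) set) \<tau> f) \<and>
        card (result X ({} :: (nat \<times> nat) set) \<tau> f) \<le> N"
      unfolding forces_def by (elim exE conjE)
    then show ?case by (simp add: result_def)
  next
    case (Suc k)
    let ?T = "\<lambda>W. finite W \<and> card W \<le> N"
    have eq: "lex_below (0, Suc k) = lex_below (0, k) \<union> {(0, k)}"
      by (auto simp: lex_below_def)
    have "forces X (lex_below (0, k)) lex_below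
       (\<lambda>W. forces (subtopology X W) {(0, k)} (\<lambda>q. lex_below q \<inter> {(0, k)}) ?T)"
      using Suc.prems unfolding eq
      by (subst (asm) forces_split) (auto simp: lex_below_def)
    then have "forces X (lex_below (0, k)) lex_below (\<lambda>W. finite W \<and> card W \<le> 2 * N)"
    proof (rule forces_mono)
      fix W assume W: "W \<subseteq> topspace X"
        "forces (subtopology X W) {(0, k)} (\<lambda>q. lex_below q \<inter> {(0, k)}) ?T"
      have "forces (subtopology X W) {(0 :: nat, k)} (\<lambda>q. {}) ?T"
        by (rule forces_weaken[OF W(2)]) (auto simp: lex_below_def)
      from step[OF this] show "finite W \<and> card W \<le> 2 * N"
        using W(1) by (simp add: inf.absorb2)
    qed
    from Suc.IH[OF this] show ?case by (simp add: mult_ac)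
  qed
  moreover have "forces X (lex_below (0, k)) lex_below (\<lambda>W. finite W \<and> card W \<le> 1)"
    using assms by (rule forces_mono) (simp add: subsingleton_def)
  ultimately show ?thesis by fastforce
qed

text \<open>The points are the strings of \<open>k\<close> bits, and move \<open>(0, b)\<close> asks
  for bit \<open>b\<close>.\<close>

lemma wins_0_discrete: "wins 0 k (discrete_topology (Pow {..<k}))"
proof (rule forcesI[where \<tau> = "\<lambda>i _. {z \<in> Pow {..<k}. snd i \<in> z}"])
  show "subsingleton (result (discrete_topology (Pow {..<k})) (lex_below (0, k))
      (\<lambda>i _. {z \<in> Pow {..<k}. snd i \<in> z}) f)" for f
  proof -
    have *: "z = {b. b < k \<and> f (0, b)}"
      if z: "z \<in> result (discrete_topology (Pow {..<k})) (lex_below (0, k)) (\<lambda>i _. {z \<in> Pow {..<k}. snd i \<in> z}) f" for z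
    proof -
      have "b \<in> z \<longleftrightarrow> f (0, b)" if "b < k" for b
        using z that by (auto simp: result_def lex_below_def split: if_splits)
      moreover have "z \<subseteq> {..<k}" using z by (auto simp: result_def)
      ultimately show ?thesis by auto
    qed
    show ?thesis unfolding subsingleton_iff
    proof (intro ballI)
      fix x y
      let ?R = "result (discrete_topology (Pow {..<k})) (lex_below (0, k))
        (\<lambda>i _. {z \<in> Pow {..<k}. snd i \<in> z}) f"
      assume "x \<in> ?R" "y \<in> ?R"
      from this[THEN *] show "x = y" by (rule trans_sym)
    qed
  qed
qed auto

lemma infinite_wins_0:
  fixes \<phi> :: "'b \<Rightarrow> 'a"
  assumes "inj \<phi>" "range \<phi> \<subseteq> topspace X" "infinite (UNIV :: 'b set)"
  shows "\<not> wins 0 k X"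
  using assms wins_0_card[of X k] by (metis finite_subset finite_imageD)

section \<open>Resolutions of the Cantor set\<close>

lemma zero_dimensional_iff:
  "zero_dimensional X \<longleftrightarrow>
    (\<forall>U x. openin X U \<and> x \<in> U \<longrightarrow> (\<exists>B. openin X B \<and> closedin X B \<and> x \<in> B \<and> B \<subseteq> U))"
proof
  assume "zero_dimensional X"
  then obtain \<B> where \<B>: "\<forall>U\<in>\<B>. openin X U \<and> closedin X U"
    and op: "openin X = arbitrary union_of (\<lambda>U. U \<in> \<B>)"
    unfolding zero_dimensional_def by (elim exE conjE)
  show "\<forall>U x. openin X U \<and> x \<in> U \<longrightarrow> (\<exists>B. openin X B \<and> closedin X B \<and> x \<in> B \<and> B \<subseteq> U)"
  proof (intro allI impI)
    fix U x assume "openin X U \<and> x \<in> U"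
    then have "(arbitrary union_of (\<lambda>U. U \<in> \<B>)) U" "x \<in> U"
      using op by simp_all
    then obtain B where "B \<in> \<B>" "x \<in> B" "B \<subseteq> U"
      by (auto simp: arbitrary_union_of_alt)
    then show "\<exists>B. openin X B \<and> closedin X B \<and> x \<in> B \<and> B \<subseteq> U"
      using \<B> by blast
  qed
next
  assume *: "\<forall>U x. openin X U \<and> x \<in> U \<longrightarrow> (\<exists>B. openin X B \<and> closedin X B \<and> x \<in> B \<and> B \<subseteq> U)"
  let ?B = "{U. openin X U \<and> closedin X U}"
  have "openin X U \<longleftrightarrow> (arbitrary union_of (\<lambda>U. U \<in> ?B)) U" for U
  proof
    assume "openin X U"
    then show "(arbitrary union_of (\<lambda>U. U \<in> ?B)) U"
      using * unfolding arbitrary_union_of_alt by simp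
  next
    assume "(arbitrary union_of (\<lambda>U. U \<in> ?B)) U"
    then show "openin X U"
      unfolding arbitrary_union_of_alt by (subst openin_subopen) blast
  qed
  then have "openin X = arbitrary union_of (\<lambda>U. U \<in> ?B)" by (intro ext)
  then show "zero_dimensional X"
    unfolding zero_dimensional_def by (intro exI[of _ ?B]) simp
qed

text \<open>Interleaving identifies \<open>nat set\<close> with its own square. In a resolution
  \<open>ev z\<close> is the Cantor coordinate and \<open>od z\<close> the position inside the
  fibre, so the new space lives on the same type as \<open>F\<close>.\<close>

definition ev :: "nat set \<Rightarrow> nat set" where "ev z = {n. 2 * n \<in> z}"
definition od :: "nat set \<Rightarrow> nat set" where "od z = {n. Suc (2 * n) \<in> z}"
definition join :: "nat set \<Rightarrow> nat set \<Rightarrow> nat set" where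
  "join x b = {n. if even n then n div 2 \<in> x else n div 2 \<in> b}"

lemma ev_join [simp]: "ev (join x b) = x"
  by (simp add: ev_def join_def)

lemma od_join [simp]: "od (join x b) = b"
  by (simp add: od_def join_def)

lemma join_ev_od [simp]: "join (ev z) (od z) = z"
  by (auto simp: ev_def od_def join_def)

lemma join_eq_iff: "join x b = join y c \<longleftrightarrow> x = y \<and> b = c"
  by (metis ev_join od_join)

definition agree :: "nat \<Rightarrow> nat set \<Rightarrow> nat set \<Rightarrow> bool" where
  "agree m x y \<longleftrightarrow> (\<forall>i<m. i \<in> x \<longleftrightarrow> i \<in> y)"

definition differ :: "nat set \<Rightarrow> nat set \<Rightarrow> nat \<Rightarrow> bool" where
  "differ x y e \<longleftrightarrow> agree e x y \<and> (e \<in> x \<longleftrightarrow> e \<notin> y)"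

lemma agree_refl [simp]: "agree m x x"
  by (simp add: agree_def)

lemma agree_trans: "agree m x y \<Longrightarrow> agree m y z \<Longrightarrow> agree m x z"
  by (simp add: agree_def)

lemma agree_mono: "agree m x y \<Longrightarrow> m' \<le> m \<Longrightarrow> agree m' x y"
  by (simp add: agree_def)

lemma differ_unique: "differ x y e \<Longrightarrow> differ x y e' \<Longrightarrow> e = e'"
  unfolding differ_def agree_def by (metis linorder_neqE_nat)

lemma differ_irrefl [simp]: "\<not> differ x x e"
  by (simp add: differ_def)

lemma differ_agree: "differ x y e \<Longrightarrow> agree (Suc e) y w \<Longrightarrow> differ x w e"
  by (simp add: differ_def agree_def)

lemma differ_ex:
  assumes "x \<noteq> y"
  shows "\<exists>e. differ x y e"
proof -
  let ?P = "\<lambda>i. \<not> (i \<in> x \<longleftrightarrow> i \<in> y)"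
  have "\<exists>i. ?P i" using assms by blast
  then have "?P (LEAST i. ?P i)" by (rule LeastI_ex)
  moreover have "\<not> ?P j" if "j < (LEAST i. ?P i)" for j
    using that by (rule not_less_Least)
  ultimately show ?thesis unfolding differ_def agree_def by blast
qed

text \<open>Meeting each nonempty open set once would not suffice: isolated points must recur at
  arbitrarily large indices, because the index is the place of a first difference and has to be
  large for blocks close to the fibre.\<close>

definition dense_seq :: "'a topology \<Rightarrow> (nat \<Rightarrow> 'a) \<Rightarrow> bool" where
  "dense_seq X g \<longleftrightarrow> range g \<subseteq> topspace X \<and>
    (\<forall>G m. openin X G \<and> G \<noteq> {} \<longrightarrow> (\<exists>e\<ge>m. g e \<in> G))"

text \<open>
  Every point \<open>x\<close> of the Cantor set is replaced by a copy of \<open>F\<close>.  The points that differ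
  from \<open>x\<close> first at \<open>e\<close> converge, as a block, to the point \<open>g e\<close> of that copy.
\<close>

locale resolution =
  fixes F :: "nat set topology" and g :: "nat \<Rightarrow> nat set"
  assumes dense: "dense_seq F g"
begin

lemma g_in: "g e \<in> topspace F"
  using dense by (auto simp: dense_seq_def)

lemma g_dense: "openin F G \<Longrightarrow> b \<in> G \<Longrightarrow> \<exists>e\<ge>m. g e \<in> G"
  using dense by (auto simp: dense_seq_def)

definition pts :: "nat set set" where "pts = {z. od z \<in> topspace F}"

text \<open>Off the fibre over \<open>x\<close> the condition ignores \<open>od z\<close>, so a
  block is either contained or missed as a whole; on the fibre it cuts out exactly
  \<open>G\<close>.\<close>

definition nbhd :: "nat set \<Rightarrow> nat set set \<Rightarrow> nat \<Rightarrow> nat set set" where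
  "nbhd x G m = {z \<in> pts. if ev z = x then od z \<in> G else \<exists>e\<ge>m. differ x (ev z) e \<and> g e \<in> G}"

definition cyl :: "nat set \<Rightarrow> nat \<Rightarrow> nat set set" where
  "cyl s m = {z \<in> pts. agree m s (ev z)}"

definition space :: "nat set topology" where
  "space = topology (\<lambda>U. U \<subseteq> pts \<and> (\<forall>z\<in>U. \<exists>G m. openin F G \<and> od z \<in> G \<and> nbhd (ev z) G m \<subseteq> U))"

lemma nbhd_mono: "G \<subseteq> G' \<Longrightarrow> m' \<le> m \<Longrightarrow> nbhd x G m \<subseteq> nbhd x G' m'"
proof
  fix z assume "G \<subseteq> G'" "m' \<le> m" "z \<in> nbhd x G m"
  then show "z \<in> nbhd x G' m'" by (cases "ev z = x") (auto simp: nbhd_def intro: order_trans)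
qed

lemma openin_space:
  "openin space U \<longleftrightarrow> U \<subseteq> pts \<and> (\<forall>z\<in>U. \<exists>G m. openin F G \<and> od z \<in> G \<and> nbhd (ev z) G m \<subseteq> U)"
proof -
  define Q where "Q U z \<longleftrightarrow> (\<exists>G m. openin F G \<and> od z \<in> G \<and> nbhd (ev z) G m \<subseteq> U)" for U z
  have Q_mono: "Q V z" if Q: "Q U z" "U \<subseteq> V" for U V z
  proof -
    obtain G m where "openin F G" "od z \<in> G" "nbhd (ev z) G m \<subseteq> U"
      using Q(1) unfolding Q_def by blast
    then show ?thesis unfolding Q_def using Q(2) by blast
  qed
  have Q_Int: "Q (U \<inter> V) z" if U: "Q U z" and V: "Q V z" for U V z
  proof -
    obtain G m where G: "openin F G" "od z \<in> G" "nbhd (ev z) G m \<subseteq> U" using U unfolding Q_def by blast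
    obtain H n where H: "openin F H" "od z \<in> H" "nbhd (ev z) H n \<subseteq> V" using V unfolding Q_def by blast
    have "nbhd (ev z) (G \<inter> H) (max m n) \<subseteq> nbhd (ev z) G m"
      "nbhd (ev z) (G \<inter> H) (max m n) \<subseteq> nbhd (ev z) H n"
      by (rule nbhd_mono; simp)+
    then have "nbhd (ev z) (G \<inter> H) (max m n) \<subseteq> U \<inter> V" using G(3) H(3) by blast
    moreover have "openin F (G \<inter> H)" "od z \<in> G \<inter> H" using G H by auto
    ultimately show ?thesis unfolding Q_def by blast
  qed
  have "istopology (\<lambda>U. U \<subseteq> pts \<and> (\<forall>z\<in>U. Q U z))"
    unfolding istopology_def
  proof (intro conjI allI impI ballI)
    fix \<K> z assume K: "\<forall>U\<in>\<K>. U \<subseteq> pts \<and> (\<forall>z\<in>U. Q U z)" and "z \<in> \<Union>\<K>"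
    from this(2) obtain U where U: "U \<in> \<K>" "z \<in> U" by (rule UnionE)
    have "Q U z" using K[rule_format, OF U(1)] U(2) by simp
    then show "Q (\<Union>\<K>) z" by (rule Q_mono) (rule Union_upper[OF U(1)])
  next
    fix \<K> assume "\<forall>U\<in>\<K>. U \<subseteq> pts \<and> (\<forall>z\<in>U. Q U z)"
    then show "\<Union>\<K> \<subseteq> pts" by blast
  next
    fix U V z assume "U \<subseteq> pts \<and> (\<forall>z\<in>U. Q U z)" "V \<subseteq> pts \<and> (\<forall>z\<in>V. Q V z)" "z \<in> U \<inter> V"
    then show "Q (U \<inter> V) z" by (intro Q_Int) simp_all
  next
    fix U V assume "U \<subseteq> pts \<and> (\<forall>z\<in>U. Q U z)"
    then show "U \<inter> V \<subseteq> pts" by (simp add: le_infI1)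
  qed
  then have "openin (topology (\<lambda>U. U \<subseteq> pts \<and> (\<forall>z\<in>U. Q U z))) = (\<lambda>U. U \<subseteq> pts \<and> (\<forall>z\<in>U. Q U z))"
    by (rule topology_inverse')
  moreover have "space = topology (\<lambda>U. U \<subseteq> pts \<and> (\<forall>z\<in>U. Q U z))"
    by (simp only: space_def Q_def)
  ultimately show ?thesis by (simp only: Q_def)
qed

lemma topspace_space: "topspace space = pts"
proof -
  have "openin space pts"
    unfolding openin_space
  proof (intro conjI ballI)
    fix z assume "z \<in> pts"
    then have "openin F (topspace F) \<and> od z \<in> topspace F \<and> nbhd (ev z) (topspace F) 0 \<subseteq> pts"
      by (auto simp: pts_def nbhd_def)
    then show "\<exists>G m. openin F G \<and> od z \<in> G \<and> nbhd (ev z) G m \<subseteq> pts" by blast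
  qed simp
  then have "pts \<subseteq> topspace space" by (rule openin_subset)
  moreover have "topspace space \<subseteq> pts"
    using openin_topspace[of space] unfolding openin_space by (rule conjunct1)
  ultimately show ?thesis by blast
qed

text \<open>A cylinder is itself a neighbourhood of each of its points: with
  \<open>G = topspace F\<close>, a first difference at \<open>e \<ge> m\<close> leaves the first
  \<open>m\<close> digits unchanged. Openness may therefore be checked at each point with whichever
  of the two shapes fits.\<close>

lemma openin_if_cyl:
  assumes "U \<subseteq> pts"
    and "\<And>z. z \<in> U \<Longrightarrow> (\<exists>m. cyl (ev z) m \<subseteq> U) \<or> (\<exists>G m. openin F G \<and> od z \<in> G \<and> nbhd (ev z) G m \<subseteq> U)"
  shows "openin space U"
  unfolding openin_space
proof (intro conjI ballI)
  fix z assume z: "z \<in> U"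
  have "\<exists>G n. openin F G \<and> od z \<in> G \<and> nbhd (ev z) G n \<subseteq> U" if m: "cyl (ev z) m \<subseteq> U" for m
  proof -
    have "nbhd (ev z) (topspace F) m \<subseteq> cyl (ev z) m"
      by (auto simp: nbhd_def cyl_def differ_def split: if_splits intro: agree_mono)
    then show ?thesis using m z assms(1) by (intro exI[of _ "topspace F"] exI[of _ m]) (auto simp: pts_def)
  qed
  then show "\<exists>G m. openin F G \<and> od z \<in> G \<and> nbhd (ev z) G m \<subseteq> U"
    using assms(2)[OF z] by blast
qed (rule assms(1))

lemma openin_cyl: "openin space (cyl s m)"
proof (rule openin_if_cyl)
  fix z assume "z \<in> cyl s m"
  then have "cyl (ev z) m \<subseteq> cyl s m" by (auto simp: cyl_def intro: agree_trans)
  then show "(\<exists>k. cyl (ev z) k \<subseteq> cyl s m) \<or> (\<exists>G k. openin F G \<and> od z \<in> G \<and> nbhd (ev z) G k \<subseteq> cyl s m)"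
    by blast
qed (auto simp: cyl_def)

text \<open>Off the fibre over \<open>x\<close>, membership depends only on the first difference
  \<open>e\<close> from \<open>x\<close>, and \<open>e\<close> is constant on the cylinder of length
  \<open>Suc e\<close> around \<open>ev z\<close>.\<close>

lemma openin_nbhd:
  assumes "openin F G"
  shows "openin space (nbhd x G m)"
proof (rule openin_if_cyl)
  fix z assume z: "z \<in> nbhd x G m"
  show "(\<exists>k. cyl (ev z) k \<subseteq> nbhd x G m) \<or> (\<exists>H k. openin F H \<and> od z \<in> H \<and> nbhd (ev z) H k \<subseteq> nbhd x G m)"
  proof (cases "ev z = x")
    case True
    then have "od z \<in> G" using z by (simp add: nbhd_def)
    then show ?thesis using True assms by blast
  next
    case False
    then obtain e where e: "e \<ge> m" "differ x (ev z) e" "g e \<in> G" using z by (auto simp: nbhd_def)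
    have "w \<in> nbhd x G m" if "w \<in> cyl (ev z) (Suc e)" for w
    proof -
      have "differ x (ev w) e" using that differ_agree[OF e(2)] by (simp add: cyl_def)
      then show ?thesis using e that by (auto simp: nbhd_def cyl_def)
    qed
    then show ?thesis by blast
  qed
qed (auto simp: nbhd_def)

text \<open>At points of the fibre the neighbourhood built from \<open>topspace F - G\<close> avoids
  this one, since the first difference \<open>e\<close> is unique and \<open>g e\<close> cannot lie
  both in \<open>G\<close> and outside. Elsewhere a cylinder with constant first difference does the
  job.\<close>

lemma closedin_nbhd:
  assumes G: "openin F (topspace F - G)"
  shows "closedin space (nbhd x G m)"
  unfolding closedin_def topspace_space
proof
  show "openin space (pts - nbhd x G m)"
  proof (rule openin_if_cyl)
    fix z assume z: "z \<in> pts - nbhd x G m"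
    show "(\<exists>k. cyl (ev z) k \<subseteq> pts - nbhd x G m) \<or>
      (\<exists>H k. openin F H \<and> od z \<in> H \<and> nbhd (ev z) H k \<subseteq> pts - nbhd x G m)"
    proof (cases "ev z = x")
      case True
      then have "od z \<in> topspace F - G" using z by (simp add: nbhd_def pts_def)
      moreover have "nbhd x (topspace F - G) m \<subseteq> pts - nbhd x G m"
        by (auto simp: nbhd_def dest: differ_unique split: if_splits)
      ultimately show ?thesis using True G by blast
    next
      case False
      then obtain e where e: "differ x (ev z) e" using differ_ex by metis
      have "w \<in> pts - nbhd x G m" if w: "w \<in> cyl (ev z) (Suc e)" for w
      proof -
        have d: "differ x (ev w) e" using w differ_agree[OF e] by (simp add: cyl_def)
        then have "ev w \<noteq> x" by auto
        then have "w \<notin> nbhd x G m"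
          using z False e differ_unique[OF d] by (auto simp: nbhd_def)
        then show ?thesis using w by (simp add: cyl_def)
      qed
      then show ?thesis by blast
    qed
  qed simp
qed (auto simp: nbhd_def)

lemma zero_dimensional_space:
  assumes "zero_dimensional F"
  shows "zero_dimensional space"
  unfolding zero_dimensional_iff
proof (intro allI impI)
  fix U z assume U: "openin space U \<and> z \<in> U"
  then obtain G m where G: "openin F G" "od z \<in> G" "nbhd (ev z) G m \<subseteq> U"
    unfolding openin_space by blast
  obtain B where B: "openin F B" "closedin F B" "od z \<in> B" "B \<subseteq> G"
    using assms G unfolding zero_dimensional_iff by meson
  have "z \<in> pts" using U openin_space by blast
  then have "z \<in> nbhd (ev z) B m" using B by (simp add: nbhd_def)
  moreover have "nbhd (ev z) B m \<subseteq> U" using nbhd_mono[OF B(4)] G(3) by (meson order_refl order_trans)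
  moreover have "closedin space (nbhd (ev z) B m)"
    by (rule closedin_nbhd) (use B(2) in \<open>simp add: closedin_def\<close>)
  ultimately show "\<exists>B. openin space B \<and> closedin space B \<and> z \<in> B \<and> B \<subseteq> U"
    using openin_nbhd[OF B(1)] by blast
qed

lemma Hausdorff_space_space:
  assumes "Hausdorff_space F"
  shows "Hausdorff_space space"
  unfolding Hausdorff_space_def topspace_space
proof (intro allI impI)
  fix z w assume zw: "z \<in> pts \<and> w \<in> pts \<and> z \<noteq> w"
  show "\<exists>U V. openin space U \<and> openin space V \<and> z \<in> U \<and> w \<in> V \<and> disjnt U V"
  proof (cases "ev z = ev w")
    case True
    then have "od z \<noteq> od w" using zw join_ev_od by metis
    then obtain U V where UV: "openin F U" "openin F V" "od z \<in> U" "od w \<in> V" "disjnt U V"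
      using assms zw unfolding Hausdorff_space_def pts_def by blast
    \<comment> \<open>A common point off the fibre would have a unique first difference
      \<open>e\<close>, with \<open>g e\<close> in both \<open>U\<close> and
      \<open>V\<close>.\<close>
    have "disjnt (nbhd (ev z) U 0) (nbhd (ev z) V 0)"
      using UV(5) unfolding disjnt_iff by (auto simp: nbhd_def dest: differ_unique split: if_splits)
    moreover have "z \<in> nbhd (ev z) U 0" "w \<in> nbhd (ev z) V 0"
      using UV zw True by (auto simp: nbhd_def)
    ultimately show ?thesis using openin_nbhd UV(1,2) by blast
  next
    case False
    then obtain e where "differ (ev z) (ev w) e" using differ_ex by blast
    then have "disjnt (cyl (ev z) (Suc e)) (cyl (ev w) (Suc e))"
      unfolding disjnt_iff by (auto simp: cyl_def differ_def agree_def)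
    moreover have "z \<in> cyl (ev z) (Suc e)" "w \<in> cyl (ev w) (Suc e)"
      using zw by (auto simp: cyl_def)
    ultimately show ?thesis using openin_cyl by blast
  qed
qed

text \<open>This is where density enters: a neighbourhood of \<open>z\<close> takes in the full
  block of every first difference \<open>e\<close> with \<open>g e \<in> G\<close>, and such
  \<open>e\<close> exist beyond any bound. Arbitrarily large \<open>e\<close> also allow the new
  cylinder to refine any given number \<open>m\<close> of digits of \<open>ev z\<close>, as the
  Hider will require.\<close>

lemma openin_contains_cyl:
  assumes "openin space U" "z \<in> U"
  obtains s n where "m < n" "agree m (ev z) s" "cyl s n \<subseteq> U"
proof -
  obtain G k where G: "openin F G" "od z \<in> G" "nbhd (ev z) G k \<subseteq> U"
    using assms unfolding openin_space by blast
  obtain e where e: "e \<ge> max m k" "g e \<in> G" using g_dense[OF G(1,2)] by blast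
  \<comment> \<open>Flipping digit \<open>e\<close> alone makes \<open>e\<close> the first
    difference, and fixing \<open>Suc e\<close> digits preserves it.\<close>
  define s where "s = {i. if i = e then i \<notin> ev z else i \<in> ev z}"
  have d: "differ (ev z) s e" by (auto simp: s_def differ_def agree_def)
  have "cyl s (Suc e) \<subseteq> nbhd (ev z) G k"
  proof
    fix w assume w: "w \<in> cyl s (Suc e)"
    then have "differ (ev z) (ev w) e" using differ_agree[OF d] by (simp add: cyl_def)
    then show "w \<in> nbhd (ev z) G k" using e w by (auto simp: nbhd_def cyl_def)
  qed
  moreover have "agree m (ev z) s" using d e by (auto simp: differ_def intro: agree_mono)
  ultimately show thesis using that[of "Suc e" s] G(3) e by simp
qed

text \<open>Every nonempty open set contains the full block of a cylinder, so a single fibre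
  coordinate, \<open>g 0\<close>, is enough; finite sets of digits meet every cylinder and are
  enumerated by \<open>set_decode\<close>.\<close>

lemma dense_seq_space: "dense_seq space (\<lambda>e. join (set_decode e) (g 0))"
  unfolding dense_seq_def
proof (intro conjI allI impI)
  show "range (\<lambda>e. join (set_decode e) (g 0)) \<subseteq> topspace space"
    using g_in by (auto simp: topspace_space pts_def)
  fix U m assume U: "openin space U \<and> U \<noteq> {}"
  then obtain z where "z \<in> U" by blast
  with U obtain s n where s: "cyl s n \<subseteq> U" using openin_contains_cyl by metis
  \<comment> \<open>The extra element \<open>n + m\<close> lies beyond the digits fixed by the
    cylinder and only pushes the code up to at least \<open>2 ^ (n + m)\<close>, so the index
    exceeds any given \<open>m\<close>.\<close>
  let ?t = "(s \<inter> {..<n}) \<union> {n + m}"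
  have t: "set_decode (set_encode ?t) = ?t" by (rule set_encode_inverse) simp
  have "m \<le> n + m" by simp
  also have "\<dots> \<le> 2 ^ (n + m)" by (rule less_imp_le, rule less_exp)
  also have "\<dots> \<le> set_encode ?t" unfolding set_encode_def by (rule member_le_sum) auto
  finally have "m \<le> set_encode ?t" .
  moreover have "agree n s ?t" by (auto simp: agree_def)
  then have "join ?t (g 0) \<in> U" using s g_in by (auto simp: cyl_def pts_def)
  ultimately show "\<exists>e\<ge>m. join (set_decode e) (g 0) \<in> U" using t by metis
qed

section \<open>Passing from \<open>F\<close> to its resolution adds \<omega> on the left\<close>

lemma wins_Suc_if_wins:
  assumes "wins n k F"
  shows "wins (Suc n) k space"
  unfolding wins_Suc
proof (rule forcesI[where \<tau> = "\<lambda>i _. {z \<in> pts. i \<in> ev z}"])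
  show "openin space {z \<in> pts. i \<in> ev z}" for i
  proof (rule openin_if_cyl)
    fix z assume "z \<in> {z \<in> pts. i \<in> ev z}"
    then have "cyl (ev z) (Suc i) \<subseteq> {z \<in> pts. i \<in> ev z}" by (auto simp: cyl_def agree_def)
    then show "(\<exists>m. cyl (ev z) m \<subseteq> {z \<in> pts. i \<in> ev z}) \<or>
        (\<exists>G m. openin F G \<and> od z \<in> G \<and> nbhd (ev z) G m \<subseteq> {z \<in> pts. i \<in> ev z})"
      by blast
  qed simp
  show "wins n k (subtopology space (result space UNIV (\<lambda>i _. {z \<in> pts. i \<in> ev z}) f))" for f
  proof -
    let ?W = "result space UNIV (\<lambda>i _. {z \<in> pts. i \<in> ev z}) f"
    have W: "z \<in> pts" "ev z = {i. f i}" if "z \<in> ?W" for z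
      using that by (auto simp: result_def topspace_space)
    have top: "topspace (subtopology space ?W) = ?W"
      unfolding topspace_subtopology by (rule Int_absorb1) (auto simp: result_def)
    show ?thesis
    \<comment> \<open>All digits are now known, so the residual set lies in one fibre and
      \<open>od\<close> carries it continuously and injectively into \<open>F\<close>.\<close>
    proof (rule forces_subsingleton_inj[OF _ _ assms])
      show "inj_on od (topspace (subtopology space ?W))"
        unfolding top
      proof (rule inj_on_inverseI[where g = "join {i. f i}"])
        show "join {i. f i} (od z) = z" if "z \<in> ?W" for z
          using join_ev_od[of z] unfolding W(2)[OF that] .
      qed
      show "continuous_map (subtopology space ?W) F od"
        unfolding continuous_map_def top
      proof (intro conjI allI impI)
        show "od \<in> ?W \<rightarrow> topspace F"
        proof
          show "od z \<in> topspace F" if "z \<in> ?W" for z using W(1)[OF that] by (simp add: pts_def)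
        qed
        fix G assume "openin F G"
        then have "openin space (nbhd {i. f i} G 0)" by (rule openin_nbhd)
        moreover have "z \<in> nbhd {i. f i} G 0 \<longleftrightarrow> od z \<in> G" if "z \<in> ?W" for z
          using W[OF that] by (simp add: nbhd_def)
        then have "{z \<in> ?W. od z \<in> G} = nbhd {i. f i} G 0 \<inter> ?W" by blast
        ultimately show "openin (subtopology space ?W) {z \<in> ?W. od z \<in> G}"
          unfolding openin_subtopology by blast
      qed
    qed
  qed
qed simp

text \<open>The Hider's strategy is a fusion argument in the style of Baire category. If the offered
  set misses the current cylinder the answer is negative; otherwise the cylinder shrinks to one
  inside the offered set and the answer is positive. In both cases no block over the new cylinder is
  split, and the limit of the cylinders is the fibre that survives.\<close>

lemma result_contains_fibre:
  assumes op: "\<And>i f. openin space (\<tau> i f)"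
    and dep: "\<And>i f h. (\<And>j. j < i \<Longrightarrow> f j = h j) \<Longrightarrow> \<tau> i f = \<tau> i h"
  shows "\<exists>f x. \<forall>b\<in>topspace F. join x b \<in> result space (UNIV :: nat set) \<tau> f"
proof -
  \<comment> \<open>A candidate \<open>r\<close> consists of an answer and the next cylinder, over
    which that answer is correct throughout. Requiring strictly more digits each time, even when
    nothing has to shrink, makes the cylinders converge to one Cantor point.\<close>
  define good where "good i f s m r \<longleftrightarrow> m < snd (snd r) \<and> agree m s (fst (snd r)) \<and>
    (\<forall>z\<in>cyl (fst (snd r)) (snd (snd r)). z \<in> \<tau> i f \<longleftrightarrow> fst r)" for i f s m and r :: "bool \<times> nat set \<times> nat"
  have ex: "\<exists>r. good i f s m r" for i f s m
  proof (cases "cyl s m \<inter> \<tau> i f = {}")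
    case True
    moreover have "cyl s (Suc m) \<subseteq> cyl s m" by (auto simp: cyl_def intro: agree_mono)
    ultimately show ?thesis
      by (intro exI[of _ "(False, s, Suc m)"]) (auto simp: good_def)
  next
    case False
    then obtain z where z: "z \<in> cyl s m \<inter> \<tau> i f" by blast
    have "openin space (cyl s m \<inter> \<tau> i f)" using op openin_cyl by blast
    from this z obtain t n where t: "m < n" "agree m (ev z) t" "cyl t n \<subseteq> cyl s m \<inter> \<tau> i f"
      by (rule openin_contains_cyl[where m = m])
    have "agree m s t" using z t(2) by (auto simp: cyl_def intro: agree_trans)
    then show ?thesis using t by (intro exI[of _ "(True, t, n)"]) (auto simp: good_def)
  qed
  define R where "R i f s m = (SOME r. good i f s m r)" for i f s m
  define B where "B i f s m = fst (R i f s m)" for i f s m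
  define S where "S i f s m = fst (snd (R i f s m))" for i f s m
  define M where "M i f s m = snd (snd (R i f s m))" for i f s m
  have "good i f s m (R i f s m)" for i f s m
    unfolding R_def by (rule someI_ex[OF ex])
  then have step: "m < M i f s m" "agree m s (S i f s m)"
    "z \<in> cyl (S i f s m) (M i f s m) \<Longrightarrow> z \<in> \<tau> i f \<longleftrightarrow> B i f s m" for i f s m z
    by (auto simp: good_def B_def S_def M_def)
  \<comment> \<open>\<open>st i\<close> is the situation before move \<open>i\<close>: the answers
    so far and the current cylinder with its number of fixed digits. Answers not yet given carry the
    default \<open>False\<close> and are overwritten when their turn comes.\<close>
  define st :: "nat \<Rightarrow> (nat \<Rightarrow> bool) \<times> nat set \<times> nat" where
    "st = rec_nat (\<lambda>_. False, {}, 0) (\<lambda>i (f, s, m). (f(i := B i f s m), S i f s m, M i f s m))"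
  define h where "h i = fst (st i)" for i
  define s where "s i = fst (snd (st i))" for i
  define m where "m i = snd (snd (st i))" for i
  have st_Suc: "st (Suc i) = ((h i)(i := B i (h i) (s i) (m i)), S i (h i) (s i) (m i), M i (h i) (s i) (m i))" for i
    by (simp add: st_def h_def s_def m_def split: prod.split)
  have m_less: "m i < m (Suc i)" for i
    using step(1) unfolding m_def[of "Suc i"] st_Suc by simp
  have s_Suc: "agree (m i) (s i) (s (Suc i))" for i
    using step(2) unfolding s_def[of "Suc i"] st_Suc by simp
  have i_le: "i \<le> m i" for i
    by (induction i) (use m_less in \<open>auto simp: Suc_le_eq intro: le_less_trans\<close>)
  have m_mono: "m i \<le> m j" if "i \<le> j" for i j
    using m_less by (rule lift_Suc_mono_le[OF less_imp_le that])
  have s_agree: "agree (m i) (s i) (s j)" if "i \<le> j" for i j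
    using that
  proof (induction j rule: dec_induct)
    case (step j)
    then show ?case using s_Suc[of j] m_mono[of i j] by (meson agree_mono agree_trans)
  qed simp
  \<comment> \<open>Answer \<open>j\<close> is settled at stage \<open>Suc j\<close> and never
    changes afterwards, so the diagonal is the full sequence of answers.\<close>
  define f where "f j = h (Suc j) j" for j
  have h_eq: "h i j = f j" if "j < i" for i j
    using that
  proof (induction i)
    case (Suc i)
    show ?case
    proof (cases "j = i")
      case False
      then have "h (Suc i) j = h i j" unfolding h_def[of "Suc i"] st_Suc by simp
      then show ?thesis using Suc False by simp
    qed (simp add: f_def)
  qed simp
  \<comment> \<open>Digit \<open>j\<close> can be read off at stage \<open>Suc j\<close>, because by
    then more than \<open>j\<close> digits are fixed.\<close>
  define x where "x = {j. j \<in> s (Suc j)}"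
  have x: "agree (m i) (s i) x" for i
    unfolding agree_def
  proof (intro allI impI)
    fix j assume j: "j < m i"
    have "j < m (Suc j)" using i_le[of "Suc j"] by simp
    then show "j \<in> s i \<longleftrightarrow> j \<in> x"
      using j s_agree[of i "Suc j"] s_agree[of "Suc j" i] unfolding x_def agree_def
      by (metis mem_Collect_eq nle_le)
  qed
  have "join x b \<in> \<tau> i f \<longleftrightarrow> f i" if "b \<in> topspace F" for b i
  proof -
    have "join x b \<in> cyl (s (Suc i)) (m (Suc i))"
      using that x by (simp add: cyl_def pts_def)
    then have "join x b \<in> \<tau> i (h i) \<longleftrightarrow> B i (h i) (s i) (m i)"
      unfolding s_def[of "Suc i"] m_def[of "Suc i"] st_Suc by (intro step(3)) simp
    moreover have "f i = B i (h i) (s i) (m i)"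
      unfolding f_def h_def[of "Suc i"] st_Suc by simp
    moreover have "\<tau> i (h i) = \<tau> i f" by (intro dep h_eq)
    ultimately show ?thesis by simp
  qed
  then have "\<forall>b\<in>topspace F. join x b \<in> result space UNIV \<tau> f"
    by (simp add: result_def topspace_space pts_def)
  then show ?thesis by blast
qed

text \<open>Against any strategy the Hider can keep a full fibre through the first \<omega> moves.
  The map \<open>join x\<close> places \<open>F\<close> continuously and injectively into the
  residual set, so the rest of the Seeker's strategy pulls back to a win on
  \<open>F\<close>.\<close>

lemma wins_if_wins_Suc:
  assumes "wins (Suc n) k space"
  shows "wins n k F"
proof -
  from assms obtain \<tau> where op: "\<forall>i\<in>UNIV. \<forall>f. openin space (\<tau> i f)"
    and dep: "\<forall>i\<in>UNIV. \<forall>f h. (\<forall>j\<in>{..<i}. f j = h j) \<longrightarrow> \<tau> i f = \<tau> i h"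
    and win: "\<forall>f. wins n k (subtopology space (result space (UNIV :: nat set) \<tau> f))"
    unfolding wins_Suc unfolding forces_def[of space "UNIV :: nat set"] by (elim exE conjE)
  have "\<exists>f x. \<forall>b\<in>topspace F. join x b \<in> result space (UNIV :: nat set) \<tau> f"
    by (rule result_contains_fibre) (use op dep in blast)+
  then obtain f x where x: "\<And>b. b \<in> topspace F \<Longrightarrow> join x b \<in> result space UNIV \<tau> f" by blast
  let ?W = "result space UNIV \<tau> f"
  have top: "topspace (subtopology space ?W) = ?W"
    unfolding topspace_subtopology by (rule Int_absorb1) (auto simp: result_def)
  show ?thesis
  proof (rule forces_subsingleton_inj[where \<phi> = "join x"])
    show "inj_on (join x) (topspace F)" by (metis inj_onI od_join)
    show "wins n k (subtopology space ?W)" using win by blast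
    show "continuous_map F (subtopology space ?W) (join x)"
      unfolding continuous_map_def top
    proof (intro conjI allI impI)
      show "join x \<in> topspace F \<rightarrow> ?W" using x by blast
      fix V assume "openin (subtopology space ?W) V"
      then obtain U where U: "openin space U" "V = U \<inter> ?W" unfolding openin_subtopology by blast
      show "openin F {b \<in> topspace F. join x b \<in> V}"
      proof (subst openin_subopen, intro ballI)
        fix b assume b: "b \<in> {b \<in> topspace F. join x b \<in> V}"
        then have "join x b \<in> U" using U by blast
        then obtain G m where G: "openin F G" "b \<in> G" "nbhd x G m \<subseteq> U"
          using U(1) unfolding openin_space by (metis ev_join od_join)
        have "G \<subseteq> {b \<in> topspace F. join x b \<in> V}"
        proof
          fix c assume c: "c \<in> G"
          then have F: "c \<in> topspace F" using openin_subset[OF G(1)] by blast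
          then have "join x c \<in> nbhd x G m" using c by (simp add: nbhd_def pts_def)
          then show "c \<in> {b \<in> topspace F. join x b \<in> V}" using F x G(3) U(2) by blast
        qed
        then show "\<exists>T. openin F T \<and> b \<in> T \<and> T \<subseteq> {b \<in> topspace F. join x b \<in> V}"
          using G by blast
      qed
    qed
  qed
qed

lemma not_wins_0_space: "\<not> wins 0 k space"
proof (rule infinite_wins_0)
  show "inj (\<lambda>x. join x (g 0))" by (metis ev_join injI)
  show "range (\<lambda>x. join x (g 0)) \<subseteq> topspace space"
    using g_in by (auto simp: topspace_space pts_def)
qed (simp add: Finite_Set.finite_set)

end

text \<open>The dense sequence is carried through the induction because the next resolution is built
  from it. A shorter length with a positive coefficient of \<omega> is refuted by removing one
  \<omega> and passing to \<open>F\<close>; a finite one fails because a resolution is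
  infinite.\<close>

lemma ex_space_below_omega_squared:
  "\<exists>X g. Hausdorff_space X \<and> zero_dimensional X \<and> dense_seq X g \<and> wins n k X \<and>
    (\<forall>n' k'. (n', k') \<in> lex_below (n, k) \<longrightarrow> \<not> wins n' k' (X :: nat set topology))"
proof (induction n)
  case 0
  let ?X = "discrete_topology (Pow {..<k})"
  have "\<not> wins n' k' ?X" if "(n', k') \<in> lex_below (0, k)" for n' k'
  proof -
    have "n' = 0" "k' < k" using that by (auto simp: lex_below_def)
    then show ?thesis using wins_0_card[of ?X k'] by (auto simp: card_Pow)
  qed
  moreover have "zero_dimensional ?X"
    unfolding zero_dimensional_iff by (auto simp: closedin_def)
  \<comment> \<open>Decoding a pair and discarding its second component lists every point infinitely
    often, as isolated points demand.\<close>
  moreover have "dense_seq ?X (\<lambda>e. set_decode (fst (prod_decode e)) \<inter> {..<k})"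
    unfolding dense_seq_def
  proof (intro conjI allI impI)
    fix G m assume G: "openin ?X G \<and> G \<noteq> {}"
    then obtain z where z: "z \<in> G" "z \<subseteq> {..<k}" by auto
    then have "set_decode (set_encode z) = z"
      by (intro set_encode_inverse) (auto intro: finite_subset)
    then have "set_decode (fst (prod_decode (prod_encode (set_encode z, m)))) \<inter> {..<k} \<in> G"
      using z by (simp add: inf.absorb1)
    then show "\<exists>e\<ge>m. set_decode (fst (prod_decode e)) \<inter> {..<k} \<in> G"
      using le_prod_encode_2 by blast
  qed auto
  moreover have "Hausdorff_space ?X" by simp
  ultimately show ?case using wins_0_discrete[of k]
    by (intro exI[of _ ?X] exI[of _ "\<lambda>e. set_decode (fst (prod_decode e)) \<inter> {..<k}"])
       blast
next
  case (Suc n)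
  then obtain F g where F: "Hausdorff_space F" "zero_dimensional F" "dense_seq F g" "wins n k F"
    "\<And>n' k'. (n', k') \<in> lex_below (n, k) \<Longrightarrow> \<not> wins n' k' (F :: nat set topology)"
    by blast
  interpret resolution F g by unfold_locales (rule F)
  have "\<not> wins n' k' space" if "(n', k') \<in> lex_below (Suc n, k)" for n' k'
  proof (cases n')
    case 0
    then show ?thesis using not_wins_0_space by simp
  next
    case (Suc l)
    then have "(l, k') \<in> lex_below (n, k)" using that by (auto simp: lex_below_def)
    then show ?thesis using F(5) wins_if_wins_Suc Suc by blast
  qed
  then show ?case
    using Hausdorff_space_space zero_dimensional_space dense_seq_space wins_Suc_if_wins F by blast
qed

section \<open>Disjoint sums\<close>

context
  fixes Y :: "nat \<Rightarrow> nat set topology"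
begin

text \<open>The even half holds a singleton \<open>{n}\<close> as the tag of the summand, which
  keeps a countable sum on \<open>nat set\<close>.\<close>

definition sum_pts :: "nat set set" where
  "sum_pts = {z. \<exists>n. ev z = {n} \<and> od z \<in> topspace (Y n)}"

definition sum_space :: "nat set topology" where
  "sum_space = topology (\<lambda>U. U \<subseteq> sum_pts \<and> (\<forall>n. openin (Y n) {b. join {n} b \<in> U}))"

lemma join_in_sum_pts [simp]: "join {n} b \<in> sum_pts \<longleftrightarrow> b \<in> topspace (Y n)"
  by (auto simp: sum_pts_def)

lemma openin_sum_space:
  "openin sum_space U \<longleftrightarrow> U \<subseteq> sum_pts \<and> (\<forall>n. openin (Y n) {b. join {n} b \<in> U})"
proof -
  let ?op = "\<lambda>U. U \<subseteq> sum_pts \<and> (\<forall>n. openin (Y n) {b. join {n} b \<in> U})"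
  have "istopology ?op"
    unfolding istopology_def
  proof (intro conjI allI impI)
    fix U V n assume UV: "?op U" "?op V"
    show "U \<inter> V \<subseteq> sum_pts" using UV(1) by (simp add: le_infI1)
    have "openin (Y n) ({b. join {n} b \<in> U} \<inter> {b. join {n} b \<in> V})" using UV by (intro openin_Int) simp_all
    then show "openin (Y n) {b. join {n} b \<in> U \<inter> V}" by (simp add: Collect_conj_eq)
  next
    fix \<K> n assume K: "\<forall>U\<in>\<K>. ?op U"
    show "\<Union>\<K> \<subseteq> sum_pts" by (rule Union_least) (use K in blast)
    have "openin (Y n) (\<Union> ((\<lambda>U. {b. join {n} b \<in> U}) ` \<K>))" by (rule openin_Union) (use K in blast)
    moreover have "{b. join {n} b \<in> \<Union>\<K>} = \<Union> ((\<lambda>U. {b. join {n} b \<in> U}) ` \<K>)" by blast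
    ultimately show "openin (Y n) {b. join {n} b \<in> \<Union>\<K>}" by (simp only:)
  qed
  then have "openin sum_space = ?op" unfolding sum_space_def by (rule topology_inverse')
  then show ?thesis by (simp only:)
qed

lemma topspace_sum_space: "topspace sum_space = sum_pts"
proof -
  have "openin sum_space sum_pts" by (simp add: openin_sum_space)
  then have "sum_pts \<subseteq> topspace sum_space" by (rule openin_subset)
  moreover have "topspace sum_space \<subseteq> sum_pts"
    using openin_topspace[of sum_space] unfolding openin_sum_space by (rule conjunct1)
  ultimately show ?thesis by blast
qed

lemma openin_sum_image:
  assumes "openin (Y n) B"
  shows "openin sum_space (join {n} ` B)"
  unfolding openin_sum_space
proof (intro conjI allI)
  show "join {n} ` B \<subseteq> sum_pts" using openin_subset[OF assms] by auto
  fix k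
  have "{b. join {k} b \<in> join {n} ` B} = (if k = n then B else {})"
    by (auto simp: image_iff join_eq_iff)
  then show "openin (Y k) {b. join {k} b \<in> join {n} ` B}" using assms by simp
qed

lemma zero_dimensional_sum_space:
  assumes "\<And>n. zero_dimensional (Y n)"
  shows "zero_dimensional sum_space"
  unfolding zero_dimensional_iff
proof (intro allI impI)
  fix U z assume U: "openin sum_space U \<and> z \<in> U"
  then obtain n where n: "ev z = {n}" unfolding openin_sum_space sum_pts_def by blast
  then have z: "join {n} (od z) = z" using join_ev_od[of z] by simp
  have "openin (Y n) {b. join {n} b \<in> U}" "od z \<in> {b. join {n} b \<in> U}"
    using U z unfolding openin_sum_space by simp_all
  then obtain B where B: "openin (Y n) B" "closedin (Y n) B" "od z \<in> B" "B \<subseteq> {b. join {n} b \<in> U}"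
    using assms[of n] unfolding zero_dimensional_iff by meson
  have "{b. join {k} b \<in> sum_pts - join {n} ` B} = (if k = n then topspace (Y n) - B else topspace (Y k))" for k
    by (auto simp: image_iff join_eq_iff)
  then have "closedin sum_space (join {n} ` B)"
    using B(2) openin_subset[OF B(1)]
    by (auto simp: closedin_def topspace_sum_space openin_sum_space simp del: Diff_iff mem_Collect_eq)
  moreover have "z \<in> join {n} ` B" using imageI[OF B(3), of "join {n}"] z by simp
  ultimately show "\<exists>B. openin sum_space B \<and> closedin sum_space B \<and> z \<in> B \<and> B \<subseteq> U"
    using openin_sum_image[OF B(1)] B(4) by blast
qed

lemma Hausdorff_space_sum_space:
  assumes "\<And>n. Hausdorff_space (Y n)"
  shows "Hausdorff_space sum_space"
  unfolding Hausdorff_space_def topspace_sum_space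
proof (intro allI impI)
  fix z w assume zw: "z \<in> sum_pts \<and> w \<in> sum_pts \<and> z \<noteq> w"
  then obtain n k where n: "ev z = {n}" "od z \<in> topspace (Y n)" and k: "ev w = {k}" "od w \<in> topspace (Y k)"
    unfolding sum_pts_def by blast
  have z: "z = join {n} (od z)" and w: "w = join {k} (od w)"
    using n k join_ev_od[of z] join_ev_od[of w] by simp_all
  obtain U V where UV: "openin (Y n) U" "openin (Y k) V" "od z \<in> U" "od w \<in> V" "n = k \<longrightarrow> disjnt U V"
  proof (cases "n = k")
    case True
    then have "od z \<noteq> od w" using z w zw by auto
    then obtain U V where "openin (Y n) U" "openin (Y n) V" "od z \<in> U" "od w \<in> V" "disjnt U V"
      using assms[of n] n(2) k(2) True unfolding Hausdorff_space_def by blast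
    then show thesis using that[of U V] True by simp
  next
    case False
    then show thesis using that[of "topspace (Y n)" "topspace (Y k)"] n k by simp
  qed
  have "disjnt (join {n} ` U) (join {k} ` V)"
    unfolding disjnt_iff
  proof (intro allI notI)
    fix v assume v: "v \<in> join {n} ` U \<and> v \<in> join {k} ` V"
    then have "n = k" "od v \<in> U" "od v \<in> V" by (auto simp: join_eq_iff)
    then show False using UV(5) unfolding disjnt_iff by blast
  qed
  moreover have "z \<in> join {n} ` U" "w \<in> join {k} ` V"
    using imageI[OF UV(3), of "join {n}"] imageI[OF UV(4), of "join {k}"] z w by simp_all
  ultimately show "\<exists>U V. openin sum_space U \<and> openin sum_space V \<and> z \<in> U \<and> w \<in> V \<and> disjnt U V"
    using openin_sum_image UV(1,2) by blast
qed

text \<open>The first \<omega> moves ask for each summand whether the point lies in it. Without a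
  positive answer nothing is left; with one, the residual set lies in a single summand, whose
  strategy takes over.\<close>

lemma forces_omega_squared_sum_space:
  assumes "\<And>n. forces (Y n) (UNIV :: (nat \<times> nat) set) lex_below subsingleton"
  shows "forces sum_space (UNIV :: (nat \<times> nat) set) lex_below subsingleton"
  unfolding forces_omega_squared[of sum_space]
proof (rule forcesI[where \<tau> = "\<lambda>i _. join {i} ` topspace (Y i)"])
  show "forces (subtopology sum_space (result sum_space UNIV (\<lambda>i _. join {i} ` topspace (Y i)) f))
      UNIV lex_below subsingleton" (is "forces (subtopology _ ?W) _ _ _") for f
  proof -
    have top: "topspace (subtopology sum_space ?W) = ?W"
      unfolding topspace_subtopology by (rule Int_absorb1) (auto simp: result_def)
    have W: "\<exists>n. f n \<and> ev z = {n} \<and> od z \<in> topspace (Y n)" if "z \<in> ?W" for z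
    proof -
      have "z \<in> sum_pts" using that by (simp add: result_def topspace_sum_space)
      then obtain n where n: "ev z = {n}" "od z \<in> topspace (Y n)" unfolding sum_pts_def by blast
      then have "join {n} (od z) = z" using join_ev_od[of z] by simp
      then have "z \<in> join {n} ` topspace (Y n)" using n(2) by force
      moreover have "\<forall>i. z \<in> join {i} ` topspace (Y i) \<longleftrightarrow> f i" using that by (simp add: result_def)
      ultimately show ?thesis using n by blast
    qed
    show ?thesis
    proof (cases "\<exists>n. f n")
      case False
      then have "?W = {}" using W by blast
      then show ?thesis using top by (intro forces_if_subsingleton) (simp add: subsingleton_def)
    next
      case True
      then obtain n where n: "f n" by blast
      have Wn: "ev z = {n}" "od z \<in> topspace (Y n)" if "z \<in> ?W" for z
      proof -
        have "z \<in> join {n} ` topspace (Y n)" using n that by (simp add: result_def)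
        then show "ev z = {n}" "od z \<in> topspace (Y n)" by auto
      qed
      show ?thesis
      proof (rule forces_subsingleton_inj[OF _ _ assms[of n]])
        show "inj_on od (topspace (subtopology sum_space ?W))"
          unfolding top
        proof (rule inj_on_inverseI[where g = "join {n}"])
          show "join {n} (od z) = z" if "z \<in> ?W" for z
            using join_ev_od[of z] unfolding Wn(1)[OF that] .
        qed
        show "continuous_map (subtopology sum_space ?W) (Y n) od"
          unfolding continuous_map_def top
        proof (intro conjI allI impI)
          show "od \<in> ?W \<rightarrow> topspace (Y n)" by (rule funcsetI) (rule Wn(2))
          fix G assume "openin (Y n) G"
          then have "openin sum_space (join {n} ` G)" by (rule openin_sum_image)
          moreover have "{z \<in> ?W. od z \<in> G} = join {n} ` G \<inter> ?W"
          proof (intro equalityI subsetI)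
            fix z assume z: "z \<in> {z \<in> ?W. od z \<in> G}"
            then have "z = join {n} (od z)"
              using join_ev_od[of z] Wn(1)[of z] by simp
            then show "z \<in> join {n} ` G \<inter> ?W" using z by blast
          qed auto
          ultimately show "openin (subtopology sum_space ?W) {z \<in> ?W. od z \<in> G}"
            unfolding openin_subtopology by blast
        qed
      qed
    qed
  qed
qed (auto intro: openin_sum_image)

lemma wins_summand_if_wins_sum_space:
  assumes "wins l k sum_space"
  shows "wins l k (Y n)"
proof (rule forces_subsingleton_inj[OF _ _ assms])
  show "inj_on (join {n}) (topspace (Y n))" by (rule inj_on_inverseI[where g = od]) simp
  show "continuous_map (Y n) sum_space (join {n})"
    unfolding continuous_map_def topspace_sum_space
  proof (intro conjI allI impI)
    fix U assume U: "openin sum_space U"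
    then have "U \<subseteq> sum_pts" unfolding openin_sum_space by (rule conjunct1)
    then have "{b \<in> topspace (Y n). join {n} b \<in> U} = {b. join {n} b \<in> U}"
      using join_in_sum_pts[of n] by blast
    then show "openin (Y n) {b \<in> topspace (Y n). join {n} b \<in> U}"
      using U by (simp add: openin_sum_space)
  qed auto
qed

end

lemma ex_space_omega_squared:
  "\<exists>X :: nat set topology. Hausdorff_space X \<and> zero_dimensional X \<and>
    forces X (UNIV :: (nat \<times> nat) set) lex_below subsingleton \<and> (\<forall>n k. \<not> wins n k X)"
proof -
  have "\<forall>n. \<exists>X :: nat set topology. Hausdorff_space X \<and> zero_dimensional X \<and> wins n 0 X \<and>
      (\<forall>n' k'. (n', k') \<in> lex_below (n, 0) \<longrightarrow> \<not> wins n' k' X)"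
  proof
    show "\<exists>X :: nat set topology. Hausdorff_space X \<and> zero_dimensional X \<and> wins n 0 X \<and>
        (\<forall>n' k'. (n', k') \<in> lex_below (n, 0) \<longrightarrow> \<not> wins n' k' X)" for n
      using ex_space_below_omega_squared[of n 0] by blast
  qed
  from choice[OF this] obtain Y :: "nat \<Rightarrow> nat set topology" where
    Y_all: "\<forall>n. Hausdorff_space (Y n) \<and> zero_dimensional (Y n) \<and> wins n 0 (Y n) \<and>
      (\<forall>n' k'. (n', k') \<in> lex_below (n, 0) \<longrightarrow> \<not> wins n' k' (Y n))"
    by (elim exE)
  have Y: "Hausdorff_space (Y n)" "zero_dimensional (Y n)" "wins n 0 (Y n)"
    "(n', k') \<in> lex_below (n, 0) \<Longrightarrow> \<not> wins n' k' (Y n)" for n n' k'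
    using Y_all by simp_all
  have "\<not> wins n k (sum_space Y)" for n k
  proof -
    \<comment> \<open>As \<omega> \<cdot> n + k lies below \<omega> \<cdot> (n + 1), the summand
      with index \<open>Suc n\<close> already defeats this length.\<close>
    have "(n, k) \<in> lex_below (Suc n, 0)" by (simp add: lex_below_def)
    from Y(4)[OF this] show ?thesis using wins_summand_if_wins_sum_space by metis
  qed
  then show ?thesis
    using Hausdorff_space_sum_space[OF Y(1)] zero_dimensional_sum_space[OF Y(2)]
      forces_omega_squared_sum_space[OF forces_omega_squared_if_wins[OF Y(3)]]
    by (intro exI[of _ "sum_space Y"] conjI allI)
qed

section \<open>Transfer to arbitrary well-orders\<close>

text \<open>An order isomorphism matches strict predecessors with those inside \<open>D\<close>, and
  downward closure makes the latter all of \<open>lex_below\<close>. The type indexing the moves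
  thus becomes irrelevant.\<close>

lemma seeker_wins_iff_forces:
  assumes iso: "(r, Restr omega_squared D) \<in> ordIso" and D: "\<And>p. p \<in> D \<Longrightarrow> lex_below p \<subseteq> D"
  shows "seeker_wins X r \<longleftrightarrow> forces X D lex_below subsingleton"
proof -
  have r: "Well_order r" using iso by (simp add: ordIso_def)
  have "Field (Restr omega_squared D) = D"
    by (auto simp: Field_def omega_squared_def)
  then obtain h where h: "bij_betw h (Field r) D"
    and ord: "\<And>i j. i \<in> Field r \<Longrightarrow> j \<in> Field r \<Longrightarrow> (i, j) \<in> r \<longleftrightarrow> (h i, h j) \<in> Restr omega_squared D"
    using iso unfolding ordIso_def iso_iff2 by auto
  have hF: "h i \<in> D" if "i \<in> Field r" for i using h that by (auto simp: bij_betw_def)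
  have hi: "h i = h j \<longleftrightarrow> i = j" if "i \<in> Field r" "j \<in> Field r" for i j
    using h that by (auto simp: bij_betw_def inj_on_def)
  have below: "p \<in> lex_below q \<longleftrightarrow> (p, q) \<in> omega_squared \<and> p \<noteq> q" for p q
    unfolding underS_omega_squared[symmetric] by (auto simp: underS_def)
  have "lex_below (h i) = h ` underS r i" if i: "i \<in> Field r" for i
  proof (intro equalityI subsetI)
    fix p assume p: "p \<in> lex_below (h i)"
    then have "p \<in> h ` Field r" using D[OF hF[OF i]] h by (auto simp: bij_betw_def)
    then obtain j where j: "j \<in> Field r" "p = h j" by blast
    then show "p \<in> h ` underS r i"
      using p ord[OF j(1) i] hF i hi[OF j(1) i] by (auto simp: below underS_def)
  next
    fix p assume "p \<in> h ` underS r i"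
    then obtain j where j: "j \<in> Field r" "p = h j" "(j, i) \<in> r" "j \<noteq> i"
      by (auto simp: underS_def Field_def)
    then show "p \<in> lex_below (h i)" using ord[OF j(1) i] hi[OF j(1) i] by (auto simp: below)
  qed
  then have "forces X (Field r) (underS r) subsingleton \<longleftrightarrow> forces X D lex_below subsingleton"
    by (intro forces_bij[OF h]) (auto simp: underS_def Field_def)
  then show ?thesis using seeker_wins_if_forces forces_if_seeker_wins[OF r] by blast
qed

lemma ordLess_omega_squared_cases:
  assumes "(r, omega_squared) \<in> ordLess"
  obtains p where "(r, Restr omega_squared (lex_below p)) \<in> ordIso"
    "\<And>X :: nat set topology. seeker_wins X r \<longleftrightarrow> forces X (lex_below p) lex_below subsingleton"
proof -
  have "Well_order r" using assms by (simp add: ordLess_def)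
  then obtain p where p: "(r, Restr omega_squared (lex_below p)) \<in> ordIso"
    using assms ordLess_iff_ordIso_Restr[OF Well_order_omega_squared] underS_omega_squared by metis
  show thesis by (rule that[OF p seeker_wins_iff_forces[OF p]]) (rule lex_below_down)
qed

lemma Restr_lex_below_ordLeq:
  assumes "q \<notin> lex_below p"
  shows "(Restr omega_squared (lex_below p), Restr omega_squared (lex_below q)) \<in> ordLeq"
proof -
  have of: "ofilter omega_squared (lex_below p)" for p
    using wo_rel.underS_ofilter[of omega_squared p] Well_order_omega_squared
    by (simp add: wo_rel_def underS_omega_squared)
  have "lex_below p \<subseteq> lex_below q"
    using assms by (cases p; cases q) (auto simp: lex_below_def)
  then show ?thesis using ofilter_subset_ordLeq[OF Well_order_omega_squared of of] by blast
qed

theorem mainTheorem14: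
  fixes \<alpha> :: "'i rel"
  assumes "Well_order \<alpha>"
    and "(\<alpha>, omega_squared) \<in> ordLeq"
  shows "\<exists>X :: nat set topology. Hausdorff_space X \<and> zero_dimensional X \<and> is_ps X \<alpha>"
proof (cases "(\<alpha>, omega_squared) \<in> ordLess")
  case True
  then obtain p where p: "(\<alpha>, Restr omega_squared (lex_below p)) \<in> ordIso"
    "\<And>X :: nat set topology. seeker_wins X \<alpha> \<longleftrightarrow> forces X (lex_below p) lex_below subsingleton"
    by (rule ordLess_omega_squared_cases) blast
  obtain X :: "nat set topology" where X: "Hausdorff_space X" "zero_dimensional X"
    "forces X (lex_below p) lex_below subsingleton"
    "\<And>q. q \<in> lex_below p \<Longrightarrow> \<not> forces X (lex_below q) lex_below subsingleton"
    using ex_space_below_omega_squared[of "fst p" "snd p"] by auto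
  have "(\<alpha>, s) \<in> ordLeq" if s: "Well_order s" "seeker_wins X s" for s :: "'i rel"
  proof (rule ccontr)
    assume "(\<alpha>, s) \<notin> ordLeq"
    \<comment> \<open>Well-orders are linearly comparable, so a counterexample \<open>s\<close>
      would be shorter than \<alpha> and hence also a proper initial segment of
      \<open>omega_squared\<close>.\<close>
    then have "(s, omega_squared) \<in> ordLess"
      using not_ordLeq_iff_ordLess[OF s(1) assms(1)] True ordLess_transitive by blast
    then obtain q where q: "(s, Restr omega_squared (lex_below q)) \<in> ordIso"
      "\<And>X :: nat set topology. seeker_wins X s \<longleftrightarrow> forces X (lex_below q) lex_below subsingleton"
      by (rule ordLess_omega_squared_cases) blast
    \<comment> \<open>A length at which the Seeker wins is not among those excluded for
      \<open>X\<close>, which puts \<open>s\<close> at or above \<alpha> after all.\<close>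
    then have "q \<notin> lex_below p" using s X(4) by blast
    then have "(\<alpha>, s) \<in> ordLeq"
      using p(1) q(1) Restr_lex_below_ordLeq ordIso_ordLeq_trans ordLeq_ordIso_trans ordIso_symmetric
      by metis
    then show False using \<open>(\<alpha>, s) \<notin> ordLeq\<close> by simp
  qed
  then show ?thesis using X p(2) assms(1) unfolding is_ps_def by blast
next
  case False
  \<comment> \<open>Here \<alpha> is \<omega> \<cdot> \<omega> itself, and any shorter length has
    the form \<omega> \<cdot> n + k, which the disjoint sum excludes.\<close>
  then have iso: "(\<alpha>, omega_squared) \<in> ordIso" using assms(2) ordLeq_iff_ordLess_or_ordIso by blast
  obtain X :: "nat set topology" where X: "Hausdorff_space X" "zero_dimensional X"
    "forces X (UNIV :: (nat \<times> nat) set) lex_below subsingleton" "\<And>n k. \<not> wins n k X"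
    using ex_space_omega_squared by blast
  have "seeker_wins X \<alpha>"
    using seeker_wins_iff_forces[of \<alpha> UNIV X] iso X(3) by simp
  moreover have "(\<alpha>, s) \<in> ordLeq" if s: "Well_order s" "seeker_wins X s" for s :: "'i rel"
  proof (rule ccontr)
    assume "(\<alpha>, s) \<notin> ordLeq"
    then have "(s, omega_squared) \<in> ordLess"
      using not_ordLeq_iff_ordLess[OF s(1) assms(1)] iso ordLess_ordIso_trans by blast
    then obtain q where "\<And>X :: nat set topology. seeker_wins X s \<longleftrightarrow> forces X (lex_below q) lex_below subsingleton"
      by (rule ordLess_omega_squared_cases) blast
    then show False using s X(4)[of "fst q" "snd q"] by simp
  qed
  ultimately show ?thesis using X assms(1) unfolding is_ps_def by blast
qed

end
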